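(* Let $N$ be a positive integer, $\check\lambda,\check\lambda'\in\mathbb Z$, $\lambda=\sqrt N\check\lambda$, $\lambda'=\sqrt N\check\lambda'$. For distinct points $z,z'\in\mathbb P\setminus P$ one has $$[j(z'),V_\lambda(z)]=0,\qquad V_{\lambda'}(z')V_\lambda(z)=(-1)^{\lambda\lambda'}V_\lambda(z)V_{\lambda'}(z').$$
   Context: $\mathbb P$ is a complex projective line, $K$ its canonical bundle, $P\in\mathbb P$ fixed; coordinates $u$ are meromorphic functions whose only pole is a simple pole at $P$. $\mathfrak m_P$ is the space of meromorphic functions regular and vanishing at $P$, $\mathfrak m_P^z\subset\mathfrak m_P$ those also regular at $z$; $\mathbb W=S^*\mathfrak m_P$, $\mathbb W^z=S^*\mathfrak m_P^z$, vacuum $\mathbf 1$. $\kappa$ is a square root of $K$ with its connection $\nabla$ having a regular singular point at $P$ and otherwise regular; for a coordinate $u$ there is a section $\sqrt{du}$ with $\nabla\sqrt{du}=0$ away from $P$. $\mathcal K^*(\kappa)$ is the set of nonzero meromorphic sections of $\kappa$; $\mathcal K^*_l(\kappa)=\{\sigma:\mathrm{Res}_P(\sigma^{-1}\nabla\sigma)=l\}$, $l\in\mathbb Z$; a superscript $z$ denotes sections regular and nonvanishing at $z$. $\tilde{\mathbb W}_l$ is the space of maps $\rho:\mathcal K_l^*(\kappa)\to\mathbb W$ with $\rho(t\sigma)=t^{Nl}\rho(\sigma)$ for $t\in\mathbb C^*$ and nonzero on only finitely many $\mathbb C^*$-orbits; $\tilde{\mathbb W}_l^z$ is defined similarly by maps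 $\mathcal K_l^*(\kappa)^z\to\mathbb W^z$. $\tilde{\mathbb W}=\oplus_l\tilde{\mathbb W}_l$, $\tilde{\mathbb W}^z=\oplus_l\tilde{\mathbb W}^z_l$. For $\mathtt v\in\mathbb W$, $\sigma\in\mathcal K_l^*(\kappa)$, $\mathtt v\hat\otimes E[\sigma]$ is the map $t\sigma\mapsto t^{Nl}\mathtt v$, zero off $\mathbb C^*\sigma$; so $\mathtt v\hat\otimes E[\sigma]=t^{Nl}\,\mathtt v\hat\otimes E[t\sigma]$. Functions in $\mathfrak m_P$ act by multiplication in the factor $\mathbb W$. $\digamma$ is the one-dimensional space spanned by $du$; evaluation identifies $\digamma$ with $K_z$ for each $z\ne P$, and values at $z$ of forms are regarded as elements of $\digamma$ (so $du_z=du_{z'}$ in $\digamma$). Tensor factors of $\digamma$, $\kappa_z$, $\kappa_{z'}$ are commuted without signs. Fields, for $z\ne P$: $\epsilon(z):\tilde{\mathbb W}\to\tilde{\mathbb W}\otimes\digamma$ is multiplication by $\frac{1}{u-u(z)}\otimes du_z$; $\iota(z):\tilde{\mathbb W}^z\to\tilde{\mathbb W}\otimes\digamma$ is defined by $[\iota(z),\beta]=-d\beta(z)$ for $\beta\in\mathfrak m_P^z$ and $\iota(z)(\mathbf 1\hat\otimes E[\sigma])=-\sqrt N\,\sigma(z)^{-1}\nabla\sigma(z)\,\mathbf 1\hat\otimes E[\sigma]$ for $\sigma$ regular and nonvanishing at $z$; $j(z)=\epsilon(z)+\iota(z)$. For $\lambda=\sqrt N\check\lambda$, $\check\lambda\in\mathbb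 Z$, the field $V_\lambda(z):\tilde{\mathbb W}^z_l\to\tilde{\mathbb W}_{l+\check\lambda}\otimes\kappa_z^{N\check\lambda}\otimes\digamma^{-N\check\lambda(l+\check\lambda)}$ is defined by $$[V_\lambda(z),\beta]=-\lambda\,\beta(z)\,V_\lambda(z)\quad(\beta\in\mathfrak m_P^z),\qquad V_\lambda(z)(\mathbf 1\hat\otimes E[\sigma])=\mathbf 1\hat\otimes E[(u-u(z))^{-\check\lambda}\sigma]\;\sigma(z)^{N\check\lambda}\,du_z^{-N\check\lambda(l+\check\lambda)}$$ for $\sigma\in\mathcal K_l^*(\kappa)^z$. It is independent of the choice of coordinate $u$ and of the representative of $E[\sigma]$. Compositions are taken on vectors built from functions and sections regular (sections also nonvanishing) at both $z$ and $z'$. Note $\lambda\lambda'=N\check\lambda\check\lambda'\in\mathbb Z$. *)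

theory Defs
  imports
    "HOL-Complex_Analysis.Complex_Analysis"
    "HOL-Library.Poly_Mapping"
    "HOL-Library.Multiset"
    "HOL-Library.Function_Algebras"
begin

section \<open>Meromorphic functions on the projective line\<close>

text \<open>
  The pair consisting of the projective line and its marked point \<open>P\<close> is realized as the Riemann
  sphere with \<open>P = \<infinity>\<close>, so that the complement of \<open>P\<close> is the type \<^typ>\<open>complex\<close>. The identity of
  \<^typ>\<open>complex\<close> is one coordinate, written \<open>x\<close> below; it only serves to write down sections of line
  bundles. All coordinates are treated on the same footing, see \<open>coordinate\<close>.

  A meromorphic function is represented by its values on \<^typ>\<open>complex\<close>, normalized to be \<open>0\<close> at
  poles and continuous elsewhere.
\<close>

definition meromorphic_at_P :: "(complex \<Rightarrow> complex) \<Rightarrow> bool" where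
  "meromorphic_at_P f \<longleftrightarrow> (\<lambda>w. f (inverse w)) meromorphic_on {0}"

lemma nicely_meromorphic_eqI:
  assumes "f nicely_meromorphic_on UNIV" "g nicely_meromorphic_on UNIV"
    and ev: "\<And>z. eventually (\<lambda>w. f w = g w) (at z)"
  shows "f = g"
proof
  fix z
  have F: "(is_pole f z \<and> f z = 0) \<or> f \<midarrow>z\<rightarrow> f z"
    and G: "(is_pole g z \<and> g z = 0) \<or> g \<midarrow>z\<rightarrow> g z"
    using assms by (auto simp: nicely_meromorphic_on_def)
  have pole: "is_pole f z \<longleftrightarrow> is_pole g z"
    by (rule is_pole_cong) (use ev in auto)
  have lim: "f \<midarrow>z\<rightarrow> c \<longleftrightarrow> g \<midarrow>z\<rightarrow> c" for c
    by (rule tendsto_cong) (rule ev)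
  show "f z = g z"
  proof (cases "is_pole f z")
    case True
    then have "\<not> f \<midarrow>z\<rightarrow> f z" "\<not> g \<midarrow>z\<rightarrow> g z"
      using pole not_tendsto_and_filterlim_at_infinity[of "at z"]
      by (auto simp: is_pole_def)
    then show ?thesis using F G by simp
  next
    case False
    then have "g \<midarrow>z\<rightarrow> f z" "g \<midarrow>z\<rightarrow> g z" using F G pole lim by auto
    then show ?thesis by (rule LIM_unique)
  qed
qed

lemma remove_sings_eventually_at_P:
  assumes "meromorphic_at_P h"
  shows "eventually (\<lambda>w. remove_sings h (inverse w) = h (inverse w)) (at 0)"
proof -
  let ?k = "\<lambda>w. h (inverse w)"
  have "isolated_singularity_at ?k 0"
    using assms by (auto simp: meromorphic_at_P_def meromorphic_at_iff)
  then have "eventually (\<lambda>w. ?k analytic_on {w}) (at 0)"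
    using isolated_singularity_at_altdef by blast
  moreover have "eventually (\<lambda>w. w \<noteq> (0::complex)) (at 0)"
    by (simp add: eventually_at_filter)
  ultimately show ?thesis
  proof eventually_elim
    case (elim w)
    have "(?k \<circ> inverse) analytic_on {inverse w}"
      by (rule analytic_on_compose) (use elim in \<open>auto intro!: analytic_intros\<close>)
    then have "h analytic_on {inverse w}"
      by (simp add: o_def)
    then show ?case by (rule remove_sings_at_analytic)
  qed
qed

lemma meromorphic_at_P_remove_sings:
  assumes "meromorphic_at_P h"
  shows "meromorphic_at_P (remove_sings h)"
proof -
  have "(\<lambda>w. remove_sings h (inverse w)) meromorphic_on {0} \<longleftrightarrow>
        (\<lambda>w. h (inverse w)) meromorphic_on {0}"
    by (rule meromorphic_on_cong) (use remove_sings_eventually_at_P[OF assms] in auto)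
  then show ?thesis using assms by (simp add: meromorphic_at_P_def)
qed

lemma remove_sings_eventually:
  assumes "h meromorphic_on UNIV"
  shows "eventually (\<lambda>w. remove_sings h w = h w) (at z)"
  using assms by (intro eventually_remove_sings_eq_at meromorphic_on_isolated_singularity)
    (auto intro: meromorphic_on_subset)

typedef mero = "{f. f nicely_meromorphic_on UNIV \<and> meromorphic_at_P f}"
  morphisms val Abs_mero
  by (rule exI[of _ "\<lambda>_. 0"])
     (auto simp: meromorphic_at_P_def intro!: meromorphic_intros)

setup_lifting type_definition_mero

lemma nice_sum:
  assumes "f nicely_meromorphic_on UNIV \<and> meromorphic_at_P f"
    "g nicely_meromorphic_on UNIV \<and> meromorphic_at_P g"
  shows "remove_sings (\<lambda>z. f z + g z) nicely_meromorphic_on UNIV \<and>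
    meromorphic_at_P (remove_sings (\<lambda>z. f z + g z))"
  using assms
  by (intro conjI remove_sings_nicely_meromorphic meromorphic_at_P_remove_sings)
     (auto simp: meromorphic_at_P_def nicely_meromorphic_on_def intro!: meromorphic_intros)

lemma nice_prod:
  assumes "f nicely_meromorphic_on UNIV \<and> meromorphic_at_P f"
    "g nicely_meromorphic_on UNIV \<and> meromorphic_at_P g"
  shows "remove_sings (\<lambda>z. f z * g z) nicely_meromorphic_on UNIV \<and>
    meromorphic_at_P (remove_sings (\<lambda>z. f z * g z))"
  using assms
  by (intro conjI remove_sings_nicely_meromorphic meromorphic_at_P_remove_sings)
     (auto simp: meromorphic_at_P_def nicely_meromorphic_on_def intro!: meromorphic_intros)

lift_definition cst :: "complex \<Rightarrow> mero" is "\<lambda>c _. c"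
  by (auto simp: meromorphic_at_P_def intro!: meromorphic_intros)

instantiation mero :: "{zero, one, plus, minus, uminus, times, inverse}"
begin
definition "0 = cst 0"
definition "1 = cst 1"
lift_definition plus_mero :: "mero \<Rightarrow> mero \<Rightarrow> mero" is
  "\<lambda>f g. remove_sings (\<lambda>z. f z + g z)" by (rule nice_sum)
lift_definition times_mero :: "mero \<Rightarrow> mero \<Rightarrow> mero" is
  "\<lambda>f g. remove_sings (\<lambda>z. f z * g z)" by (rule nice_prod)
lift_definition uminus_mero :: "mero \<Rightarrow> mero" is "\<lambda>f z. - f z"
  by (auto simp: meromorphic_at_P_def intro!: meromorphic_intros)
lift_definition inverse_mero :: "mero \<Rightarrow> mero" is "\<lambda>f z. inverse (f z)"
  by (auto simp: meromorphic_at_P_def intro!: meromorphic_intros)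
definition "f - g = f + - (g :: mero)"
definition "f div g = f * inverse (g :: mero)"
instance ..
end

lemma val_nice: "val f nicely_meromorphic_on UNIV" and val_at_P: "meromorphic_at_P (val f)"
  using val[of f] by auto

lemma val_mero: "val f meromorphic_on A"
  using val_nice[of f] meromorphic_on_subset by (auto simp: nicely_meromorphic_on_def)

lemma mero_eqI:
  assumes "\<And>z. eventually (\<lambda>w. val f w = val g w) (at z)"
  shows "f = g"
  using nicely_meromorphic_eqI[OF val_nice val_nice assms] by (simp add: val_inject)

lemma val_cst [simp]: "val (cst c) = (\<lambda>_. c)"
  by transfer simp

lemma val_0 [simp]: "val 0 = (\<lambda>_. 0)" and val_1 [simp]: "val 1 = (\<lambda>_. 1)"
  by (simp_all add: zero_mero_def one_mero_def)

lemma val_uminus [simp]: "val (- f) = (\<lambda>z. - val f z)"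
  by transfer simp

lemma val_inverse [simp]: "val (inverse f) = (\<lambda>z. inverse (val f z))"
  by transfer simp

lemma val_add: "eventually (\<lambda>w. val (f + g) w = val f w + val g w) (at z)"
  unfolding plus_mero.rep_eq
  by (rule remove_sings_eventually) (intro meromorphic_intros val_mero)

lemma val_mult: "eventually (\<lambda>w. val (f * g) w = val f w * val g w) (at z)"
  unfolding times_mero.rep_eq
  by (rule remove_sings_eventually) (intro meromorphic_intros val_mero)

lemma mero_nonzero:
  assumes "f \<noteq> 0"
  shows "eventually (\<lambda>w. val f w \<noteq> 0) (at z)"
proof -
  have "(\<forall>x\<in>UNIV. val f x = 0) \<or> (\<forall>\<^sub>\<approx>x\<in>UNIV. val f x \<noteq> 0)"
    by (rule nicely_meromorphic_imp_constant_or_avoid[OF val_nice]) auto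
  moreover have "\<not> (\<forall>x\<in>UNIV. val f x = 0)"
    using assms by (metis UNIV_I ext val_0 val_inject)
  ultimately show ?thesis
    using eventually_cosparse_imp_eventually_at by blast
qed

instance mero :: field
proof
  fix a b c :: mero
  show "a + b + c = a + (b + c)"
  proof (rule mero_eqI)
    fix z show "\<forall>\<^sub>F w in at z. val (a + b + c) w = val (a + (b + c)) w"
      using val_add[of "a + b" c z] val_add[of a b z] val_add[of a "b + c" z] val_add[of b c z]
      by eventually_elim simp
  qed
  show "a + b = b + a"
    by (simp add: plus_mero_def add.commute)
  show "0 + a = a"
  proof (rule mero_eqI)
    fix z show "\<forall>\<^sub>F w in at z. val (0 + a) w = val a w"
      using val_add[of 0 a z] by eventually_elim simp
  qed
  show "- a + a = 0"
  proof (rule mero_eqI)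
    fix z show "\<forall>\<^sub>F w in at z. val (- a + a) w = val 0 w"
      using val_add[of "- a" a z] by eventually_elim simp
  qed
  show "a - b = a + - b" by (simp add: minus_mero_def)
  show "a * b * c = a * (b * c)"
  proof (rule mero_eqI)
    fix z show "\<forall>\<^sub>F w in at z. val (a * b * c) w = val (a * (b * c)) w"
      using val_mult[of "a * b" c z] val_mult[of a b z] val_mult[of a "b * c" z] val_mult[of b c z]
      by eventually_elim simp
  qed
  show "a * b = b * a"
    by (simp add: times_mero_def mult.commute)
  show "1 * a = a"
  proof (rule mero_eqI)
    fix z show "\<forall>\<^sub>F w in at z. val (1 * a) w = val a w"
      using val_mult[of 1 a z] by eventually_elim simp
  qed
  show "(a + b) * c = a * c + b * c"
  proof (rule mero_eqI)
    fix z show "\<forall>\<^sub>F w in at z. val ((a + b) * c) w = val (a * c + b * c) w"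
      using val_mult[of "a + b" c z] val_add[of a b z] val_add[of "a * c" "b * c" z]
        val_mult[of a c z] val_mult[of b c z]
      by eventually_elim (simp add: algebra_simps)
  qed
  show "(0::mero) \<noteq> 1"
    by (metis val_0 val_1 zero_neq_one)
  show "inverse a * a = 1" if "a \<noteq> 0"
  proof (rule mero_eqI)
    fix z show "\<forall>\<^sub>F w in at z. val (inverse a * a) w = val 1 w"
      using val_mult[of "inverse a" a z] mero_nonzero[OF that, of z] by eventually_elim simp
  qed
  show "a div b = a * inverse b" by (simp add: divide_mero_def)
  show "inverse (0::mero) = 0" by (simp add: zero_mero_def inverse_mero_def val_cst)
      (simp add: cst_def)
qed

definition regular_at :: "mero \<Rightarrow> complex \<Rightarrow> bool" where
  "regular_at f z \<longleftrightarrow> val f analytic_on {z}"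

definition coordinate :: "mero \<Rightarrow> bool" where
  "coordinate u \<longleftrightarrow> (\<forall>z. regular_at u z) \<and>
     is_pole (\<lambda>w. val u (inverse w)) 0 \<and> zorder (\<lambda>w. val u (inverse w)) 0 = -1"

text \<open>
  The line \<open>\<digamma>\<close> and all the cotangent lines \<open>K\<^sub>z\<close> are identified with \<^typ>\<open>complex\<close> by means of
  their common basis vector \<open>dx\<close>. The value at \<open>z\<close> of the form \<open>df\<close> is thus the number \<open>f'(z)\<close>.
\<close>

definition d_at :: "mero \<Rightarrow> complex \<Rightarrow> complex" where
  "d_at f z = deriv (val f) z"


section \<open>The space \<open>\<mm>\<^sub>P\<close> and its symmetric algebra\<close>

definition vanishes_at_P :: "mero \<Rightarrow> bool" where
  "vanishes_at_P f \<longleftrightarrow> (val f \<longlongrightarrow> 0) at_infinity"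

lemma eventually_at_infinity_inverse:
  fixes Q :: "complex \<Rightarrow> bool"
  shows "eventually Q at_infinity \<longleftrightarrow> eventually (\<lambda>w. Q (inverse w)) (at 0)"
  by (simp add: at_to_infinity eventually_filtermap)

lemma val_add_at_infinity:
  "eventually (\<lambda>w. val (f + g) w = val f w + val g w) at_infinity"
  unfolding plus_mero.rep_eq eventually_at_infinity_inverse
  by (rule remove_sings_eventually_at_P)
     (use val_at_P in \<open>auto simp: meromorphic_at_P_def intro!: meromorphic_intros\<close>)

lemma val_mult_at_infinity:
  "eventually (\<lambda>w. val (f * g) w = val f w * val g w) at_infinity"
  unfolding times_mero.rep_eq eventually_at_infinity_inverse
  by (rule remove_sings_eventually_at_P)
     (use val_at_P in \<open>auto simp: meromorphic_at_P_def intro!: meromorphic_intros\<close>)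

lemma vanishes_at_P_0: "vanishes_at_P 0"
  by (simp add: vanishes_at_P_def)

lemma vanishes_at_P_add:
  assumes "vanishes_at_P f" "vanishes_at_P g"
  shows "vanishes_at_P (f + g)"
  using tendsto_add[of "val f" 0 at_infinity "val g" 0] assms
    tendsto_cong[OF val_add_at_infinity[of f g], of 0]
  by (simp add: vanishes_at_P_def)

lemma vanishes_at_P_uminus: "vanishes_at_P f \<Longrightarrow> vanishes_at_P (- f)"
  using tendsto_minus[of "val f" 0 at_infinity] by (simp add: vanishes_at_P_def)

lemma vanishes_at_P_cst_mult:
  assumes "vanishes_at_P f"
  shows "vanishes_at_P (cst c * f)"
  using tendsto_mult_left[of "val f" 0 at_infinity c] assms
    tendsto_cong[OF val_mult_at_infinity[of "cst c" f], of 0]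
  by (simp add: vanishes_at_P_def)

typedef mP = "{f. vanishes_at_P f}"
  morphisms fun_of Abs_mP
  using vanishes_at_P_0 by blast

setup_lifting type_definition_mP

instantiation mP :: ab_group_add
begin
lift_definition zero_mP :: mP is 0 by (rule vanishes_at_P_0)
lift_definition plus_mP :: "mP \<Rightarrow> mP \<Rightarrow> mP" is "(+)" by (rule vanishes_at_P_add)
lift_definition uminus_mP :: "mP \<Rightarrow> mP" is uminus by (rule vanishes_at_P_uminus)
lift_definition minus_mP :: "mP \<Rightarrow> mP \<Rightarrow> mP" is "(-)"
  using vanishes_at_P_add vanishes_at_P_uminus by (metis diff_conv_add_uminus)
instance by standard (transfer; simp)+
end

lift_definition scale_mP :: "complex \<Rightarrow> mP \<Rightarrow> mP" is "\<lambda>c f. cst c * f"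
  by (rule vanishes_at_P_cst_mult)

text \<open>
  \<^typ>\<open>mP multiset \<Rightarrow>\<^sub>0 complex\<close> is the polynomial algebra with one variable for each element of
  \<open>\<mm>\<^sub>P\<close>. The symmetric algebra is its quotient by the ideal which makes the map from \<open>\<mm>\<^sub>P\<close> to the
  variables linear.
\<close>

type_synonym free_alg = "mP multiset \<Rightarrow>\<^sub>0 complex"

definition free_const :: "complex \<Rightarrow> free_alg" where
  "free_const c = Poly_Mapping.single {#} c"

definition free_var :: "mP \<Rightarrow> free_alg" where
  "free_var b = Poly_Mapping.single {#b#} 1"

inductive_set lin_ideal :: "free_alg set" where
  ideal_add_rel: "free_var (a + b) - free_var a - free_var b \<in> lin_ideal"
| ideal_scale_rel: "free_var (scale_mP c a) - free_const c * free_var a \<in> lin_ideal"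
| ideal_zero: "0 \<in> lin_ideal"
| ideal_add: "p \<in> lin_ideal \<Longrightarrow> q \<in> lin_ideal \<Longrightarrow> p + q \<in> lin_ideal"
| ideal_mult: "p \<in> lin_ideal \<Longrightarrow> r * p \<in> lin_ideal"

lemma ideal_uminus: "p \<in> lin_ideal \<Longrightarrow> - p \<in> lin_ideal"
  using ideal_mult[of p "- 1"] by simp

lemma lookup_mult_empty:
  fixes p q :: free_alg
  shows "Poly_Mapping.lookup (p * q) {#} = Poly_Mapping.lookup p {#} * Poly_Mapping.lookup q {#}"
proof -
  let ?p = "Poly_Mapping.lookup p" and ?q = "Poly_Mapping.lookup q"
  have "(\<Sum>r. ?q r when {#} = l + r) = (?q {#} when l = {#})" for l :: "mP multiset"
  proof -
    have "(\<lambda>r. ?q r when {#} = l + r) = (\<lambda>r. (?q {#} when l = {#}) when r = {#})"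
      by (auto simp: when_def)
    then show ?thesis by (simp only: Sum_any_when_equal)
  qed
  then have "Poly_Mapping.lookup (p * q) {#} = (\<Sum>l. ?p l * (?q {#} when l = {#}))"
    by (simp add: lookup_mult)
  also have "(\<lambda>l. ?p l * (?q {#} when l = {#})) = (\<lambda>l. (?p {#} * ?q {#}) when l = {#})"
    by (auto simp: when_def)
  finally show ?thesis by simp
qed

lemma lin_ideal_lookup_empty: "p \<in> lin_ideal \<Longrightarrow> Poly_Mapping.lookup p {#} = 0"
  by (induction rule: lin_ideal.induct)
     (auto simp: lookup_mult_empty lookup_add lookup_minus free_var_def Poly_Mapping.lookup_single)

definition lin_rel :: "free_alg \<Rightarrow> free_alg \<Rightarrow> bool" where
  "lin_rel p q \<longleftrightarrow> p - q \<in> lin_ideal"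

lemma equivp_lin_rel: "equivp lin_rel"
proof (rule equivpI)
  show "reflp lin_rel" by (auto simp: reflp_def lin_rel_def ideal_zero)
  show "symp lin_rel" unfolding symp_def lin_rel_def using ideal_uminus by fastforce
  show "transp lin_rel" unfolding transp_def lin_rel_def using ideal_add by fastforce
qed

quotient_type symalg = free_alg / lin_rel
  by (rule equivp_lin_rel)

lemma lin_rel_add: "lin_rel p p' \<Longrightarrow> lin_rel q q' \<Longrightarrow> lin_rel (p + q) (p' + q')"
  using ideal_add[of "p - p'" "q - q'"] by (simp add: lin_rel_def algebra_simps)

lemma lin_rel_uminus: "lin_rel p p' \<Longrightarrow> lin_rel (- p) (- p')"
  using ideal_uminus[of "p - p'"] by (simp add: lin_rel_def)

lemma lin_rel_mult:
  assumes "lin_rel p p'" "lin_rel q q'"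
  shows "lin_rel (p * q) (p' * q')"
proof -
  have "q * (p - p') + p' * (q - q') \<in> lin_ideal"
    using assms by (intro ideal_add ideal_mult) (auto simp: lin_rel_def)
  then show ?thesis by (simp add: lin_rel_def algebra_simps)
qed

instantiation symalg :: comm_ring_1
begin
lift_definition zero_symalg :: symalg is 0 .
lift_definition one_symalg :: symalg is 1 .
lift_definition plus_symalg :: "symalg \<Rightarrow> symalg \<Rightarrow> symalg" is "(+)" by (rule lin_rel_add)
lift_definition uminus_symalg :: "symalg \<Rightarrow> symalg" is uminus by (rule lin_rel_uminus)
lift_definition minus_symalg :: "symalg \<Rightarrow> symalg \<Rightarrow> symalg" is "(-)"
  using lin_rel_add lin_rel_uminus by (metis diff_conv_add_uminus)
lift_definition times_symalg :: "symalg \<Rightarrow> symalg \<Rightarrow> symalg" is "(*)" by (rule lin_rel_mult)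
instance
proof
  show "(0::symalg) \<noteq> 1"
  proof (transfer, rule notI)
    assume "lin_rel 0 1"
    then have "Poly_Mapping.lookup (0 - 1 :: free_alg) {#} = 0"
      unfolding lin_rel_def by (rule lin_ideal_lookup_empty)
    then show False by (simp add: lookup_minus lookup_one)
  qed
qed (transfer; simp add: lin_rel_def ideal_zero algebra_simps)+
end

lift_definition sconst :: "complex \<Rightarrow> symalg" is free_const .
lift_definition sgen :: "mP \<Rightarrow> symalg" is free_var .

text \<open>
  For a set \<open>A\<close> of points different from \<open>P\<close>, the symmetric algebra of the space of those elements
  of \<open>\<mm>\<^sub>P\<close> which are regular on \<open>A\<close>, as a subalgebra of the symmetric algebra of \<open>\<mm>\<^sub>P\<close>.
  Here and below the case \<open>A = {}\<close> gives the full space, and \<open>A = {z}\<close> the one with superscript \<open>z\<close>.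
\<close>

inductive_set Wsub :: "complex set \<Rightarrow> symalg set" for A :: "complex set" where
  Wsub_const: "sconst c \<in> Wsub A"
| Wsub_gen: "(\<And>z. z \<in> A \<Longrightarrow> regular_at (fun_of b) z) \<Longrightarrow> sgen b \<in> Wsub A"
| Wsub_add: "v \<in> Wsub A \<Longrightarrow> w \<in> Wsub A \<Longrightarrow> v + w \<in> Wsub A"
| Wsub_mult: "v \<in> Wsub A \<Longrightarrow> w \<in> Wsub A \<Longrightarrow> v * w \<in> Wsub A"


section \<open>Sections of the square root of the canonical bundle\<close>

text \<open>
  Away from \<open>P\<close> the line bundle \<open>\<kappa>\<close> is trivialized by the section \<open>\<surd>dx\<close>, for which
  \<open>\<nabla> \<surd>dx = 0\<close>. The meromorphic section \<open>\<sigma> = f \<cdot> \<surd>dx\<close> is represented by the meromorphic function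
  \<open>f\<close>, and its value in \<open>\<kappa>\<^sub>z\<close> by the number \<open>f(z)\<close>. Since \<open>\<nabla>\<sigma> = df \<cdot> \<surd>dx\<close>, the form
  \<open>\<sigma>\<inverse>\<nabla>\<sigma>\<close> is \<open>(f'/f) dx\<close>.
\<close>

type_synonym ksec = mero

definition dlog :: "ksec \<Rightarrow> complex \<Rightarrow> complex" where
  "dlog \<sigma> z = deriv (val \<sigma>) z / val \<sigma> z"

text \<open>The residue at \<open>P\<close> of the form \<open>h dx\<close>; in the local parameter \<open>w = 1/x\<close> one has \<open>dx = - dw/w\<^sup>2\<close>.\<close>

definition residue_P :: "(complex \<Rightarrow> complex) \<Rightarrow> complex" where
  "residue_P h = residue (\<lambda>w. - h (inverse w) / w ^ 2) 0"

text \<open>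
  The nonzero meromorphic sections \<open>\<sigma>\<close> of \<open>\<kappa>\<close>, regular and nonvanishing on \<open>A\<close>, with
  \<open>Res\<^sub>P(\<sigma>\<inverse>\<nabla>\<sigma>) = l\<close>.
\<close>

definition Ksec :: "complex set \<Rightarrow> int \<Rightarrow> ksec set" where
  "Ksec A l = {\<sigma>. \<sigma> \<noteq> 0 \<and> residue_P (dlog \<sigma>) = of_int l \<and>
     (\<forall>z\<in>A. regular_at \<sigma> z \<and> val \<sigma> z \<noteq> 0)}"

definition orbit :: "ksec \<Rightarrow> ksec set" where
  "orbit \<sigma> = {cst t * \<sigma> | t. t \<noteq> 0}"


section \<open>The space of states\<close>

text \<open>Maps defined on a set of sections are extended by \<open>0\<close> to all sections.\<close>

type_synonym state = "ksec \<Rightarrow> symalg"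

definition Wt_deg :: "nat \<Rightarrow> complex set \<Rightarrow> int \<Rightarrow> state set" where
  "Wt_deg N A l = {\<rho>.
     (\<forall>\<sigma>. \<sigma> \<notin> Ksec A l \<longrightarrow> \<rho> \<sigma> = 0) \<and>
     (\<forall>\<sigma>\<in>Ksec A l. \<rho> \<sigma> \<in> Wsub A) \<and>
     (\<forall>\<sigma>\<in>Ksec A l. \<forall>t. t \<noteq> 0 \<longrightarrow> \<rho> (cst t * \<sigma>) = sconst (t powi (int N * l)) * \<rho> \<sigma>) \<and>
     finite (orbit ` {\<sigma>. \<rho> \<sigma> \<noteq> 0})}"

text \<open>The sum is direct, because the sets \<open>Ksec A l\<close> are disjoint.\<close>

definition Wt :: "nat \<Rightarrow> complex set \<Rightarrow> state set" where
  "Wt N A = {\<Sum>l\<in>L. \<rho> l | L \<rho>. finite L \<and> (\<forall>l\<in>L. \<rho> l \<in> Wt_deg N A l)}"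

definition smul :: "complex \<Rightarrow> state \<Rightarrow> state" where
  "smul c \<rho> = (\<lambda>\<sigma>. sconst c * \<rho> \<sigma>)"

definition fmul :: "mP \<Rightarrow> state \<Rightarrow> state" where
  "fmul b \<rho> = (\<lambda>\<sigma>. sgen b * \<rho> \<sigma>)"

text \<open>The vector \<open>v \<otimes> E[\<sigma>]\<close> for \<open>\<sigma> \<in> Ksec {} l\<close>.\<close>

definition tensE :: "nat \<Rightarrow> int \<Rightarrow> symalg \<Rightarrow> ksec \<Rightarrow> state" where
  "tensE N l v \<sigma> = (\<lambda>\<tau>. if \<tau> \<in> orbit \<sigma>
     then sconst ((THE t. \<tau> = cst t * \<sigma>) powi (int N * l)) * v else 0)"

definition linear_on_states :: "state set \<Rightarrow> (state \<Rightarrow> state) \<Rightarrow> bool" where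
  "linear_on_states S F \<longleftrightarrow>
     (\<forall>\<rho>\<in>S. \<forall>\<rho>'\<in>S. F (\<rho> + \<rho>') = F \<rho> + F \<rho>') \<and> (\<forall>c. \<forall>\<rho>\<in>S. F (smul c \<rho>) = smul c (F \<rho>))"


section \<open>Fields\<close>

text \<open>
  With the trivializations of \<open>\<digamma>\<close> by \<open>dx\<close> and of \<open>\<kappa>\<^sub>z\<close> by the value of \<open>\<surd>dx\<close> at \<open>z\<close>, all the
  fields become operators between spaces of states: \<open>du\<^sub>z\<close> is the number \<^term>\<open>d_at u z\<close> and
  \<open>\<sigma>(z)\<close> is the number \<^term>\<open>val \<sigma> z\<close>.

  The operators \<open>\<iota>(z)\<close> and \<open>V\<^sub>\<lambda>(z)\<close> are the unique linear maps on \<^term>\<open>Wt N {z}\<close> with the stated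
  properties; outside of this space they are given the value \<open>undefined\<close>.
\<close>

definition eps_field :: "mero \<Rightarrow> complex \<Rightarrow> state \<Rightarrow> state" where
  "eps_field u z \<rho> = smul (d_at u z) (fmul (Abs_mP (1 / (u - cst (val u z)))) \<rho>)"

definition is_iota_field :: "nat \<Rightarrow> complex \<Rightarrow> (state \<Rightarrow> state) \<Rightarrow> bool" where
  "is_iota_field N z I \<longleftrightarrow>
     linear_on_states (Wt N {z}) I \<and>
     I \<in> Wt N {z} \<rightarrow>\<^sub>E Wt N {} \<and>
     (\<forall>b. regular_at (fun_of b) z \<longrightarrow>
        (\<forall>\<rho>\<in>Wt N {z}. I (fmul b \<rho>) - fmul b (I \<rho>) = smul (- d_at (fun_of b) z) \<rho>)) \<and>
     (\<forall>l. \<forall>\<sigma>\<in>Ksec {z} l.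
        I (tensE N l 1 \<sigma>) = smul (- complex_of_real (sqrt N) * dlog \<sigma> z) (tensE N l 1 \<sigma>))"

definition iota_field :: "nat \<Rightarrow> complex \<Rightarrow> state \<Rightarrow> state" where
  "iota_field N z = (THE I. is_iota_field N z I)"

definition j_field :: "nat \<Rightarrow> mero \<Rightarrow> complex \<Rightarrow> state \<Rightarrow> state" where
  "j_field N u z \<rho> = eps_field u z \<rho> + iota_field N z \<rho>"

text \<open>The integer \<open>k\<close> is \<open>\<lambda>/\<surd>N\<close>.\<close>

definition is_vertex_field ::
    "nat \<Rightarrow> int \<Rightarrow> mero \<Rightarrow> complex \<Rightarrow> (state \<Rightarrow> state) \<Rightarrow> bool" where
  "is_vertex_field N k u z V \<longleftrightarrow>
     linear_on_states (Wt N {z}) V \<and>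
     V \<in> Wt N {z} \<rightarrow>\<^sub>E Wt N {} \<and>
     (\<forall>l. \<forall>\<rho>\<in>Wt_deg N {z} l. V \<rho> \<in> Wt_deg N {} (l + k)) \<and>
     (\<forall>b. regular_at (fun_of b) z \<longrightarrow>
        (\<forall>\<rho>\<in>Wt N {z}. V (fmul b \<rho>) - fmul b (V \<rho>) =
           smul (- (complex_of_real (sqrt N) * of_int k) * val (fun_of b) z) (V \<rho>))) \<and>
     (\<forall>l. \<forall>\<sigma>\<in>Ksec {z} l.
        V (tensE N l 1 \<sigma>) =
          smul (val \<sigma> z powi (int N * k) * d_at u z powi (- int N * k * (l + k)))
            (tensE N (l + k) 1 ((u - cst (val u z)) powi (- k) * \<sigma>)))"

definition vertex_field :: "nat \<Rightarrow> int \<Rightarrow> mero \<Rightarrow> complex \<Rightarrow> state \<Rightarrow> state" where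
  "vertex_field N k u z = (THE V. is_vertex_field N k u z V)"

end

theory Submission
  imports Defs
begin

text \<open>
  Both identities are verified on explicit formulas for the operators. A state \<open>\<rho>\<close> is a function on
  sections, and the degree \<open>l\<close> of a section \<open>\<sigma>\<close> can be read off from \<open>\<sigma>\<close>: the residue of its
  logarithmic derivative at \<open>P\<close> is its order of vanishing there (\<open>residue_P_dlog\<close>). With
  \<open>\<sigma> = (u - u(z))\<^sup>k \<tau>\<close> and \<open>\<mu> = - \<surd>N k\<close> one has
  \<open>(V(z) \<rho>)(\<tau>) = \<sigma>(z)\<^bsup>Nk\<^esup> du\<^sub>z\<^bsup>-Nk(l+k)\<^esup> T(\<rho>(\<sigma>))\<close> and
  \<open>(\<iota>(z) \<rho>)(\<tau>) = D(\<rho>(\<tau>)) - \<surd>N (\<tau>'(z)/\<tau>(z)) \<rho>(\<tau>)\<close>.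
  Here \<open>T\<close> is the algebra homomorphism with \<open>\<beta> \<mapsto> \<beta> + \<mu> \<beta>(z)\<close> for functions \<open>\<beta>\<close> regular at \<open>z\<close>,
  and \<open>D\<close> is the derivation with \<open>\<beta> \<mapsto> - d\<beta>(z)\<close>. The right-hand sides are linear with the prescribed
  commutators and vacuum values, and these properties determine an operator, because the states
  \<open>1 \<otimes> E[\<sigma>]\<close> generate the whole space under linear combinations and multiplication by functions
  (\<open>Wt_induct\<close>, \<open>operator_unique\<close>). This gives \<open>iota_field_eq\<close> and \<open>vertex_field_eq\<close>.

  The homomorphisms \<open>T\<close> and derivations \<open>D\<close> at any two points commute, since this holds on generators.
  The rest is a computation with scalars. In the first identity, the commutator of \<open>\<epsilon>(z')\<close> with
  \<open>V(z)\<close> contributes a multiple of \<open>1/(u(z) - u(z'))\<close>; it cancels the change \<open>k/(z' - z)\<close> of the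
  logarithmic derivative at \<open>z'\<close> caused by the factor \<open>(u - u(z))\<^sup>k\<close>. In the second one, the two
  products differ by the ratio of \<open>(u(z') - u(z))\<^bsup>-Nkk'\<^esup>\<close> to \<open>(u(z) - u(z'))\<^bsup>-Nkk'\<^esup>\<close>, which is the
  sign. Both computations use that a coordinate is an affine function of \<open>x\<close>
  (\<open>coordinate_affine\<close>, by Liouville's theorem), so that \<open>du\<close> is a constant multiple of \<open>dx\<close>.
\<close>

section \<open>Values and logarithmic derivatives of meromorphic functions\<close>

lemma regular_at_cst [simp]: "regular_at (cst c) z" "regular_at 0 z" "regular_at 1 z"
  by (auto simp: regular_at_def)

lemma regular_add:
  assumes "regular_at f z" "regular_at g z"
  shows "regular_at (f + g) z" "val (f + g) z = val f z + val g z"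
proof -
  have an: "(\<lambda>w. val f w + val g w) analytic_on {z}"
    using assms by (auto simp: regular_at_def intro!: analytic_intros)
  show "regular_at (f + g) z"
    unfolding regular_at_def plus_mero.rep_eq by (rule remove_sings_analytic_on[OF an])
  show "val (f + g) z = val f z + val g z"
    unfolding plus_mero.rep_eq by (rule remove_sings_at_analytic[OF an])
qed

lemma regular_mult:
  assumes "regular_at f z" "regular_at g z"
  shows "regular_at (f * g) z" "val (f * g) z = val f z * val g z"
proof -
  have an: "(\<lambda>w. val f w * val g w) analytic_on {z}"
    using assms by (auto simp: regular_at_def intro!: analytic_intros)
  show "regular_at (f * g) z"
    unfolding regular_at_def times_mero.rep_eq by (rule remove_sings_analytic_on[OF an])
  show "val (f * g) z = val f z * val g z"
    unfolding times_mero.rep_eq by (rule remove_sings_at_analytic[OF an])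
qed

lemma regular_uminus:
  assumes "regular_at f z" shows "regular_at (- f) z"
  using assms by (auto simp: regular_at_def intro!: analytic_intros)

lemma regular_diff:
  assumes "regular_at f z" "regular_at g z"
  shows "regular_at (f - g) z" "val (f - g) z = val f z - val g z"
  using regular_add[OF assms(1) regular_uminus[OF assms(2)]] by simp_all

lemma regular_inverse:
  assumes "regular_at f z" "val f z \<noteq> 0"
  shows "regular_at (inverse f) z"
  using assms by (auto simp: regular_at_def intro!: analytic_intros)

text \<open>Units of the local ring at \<open>z\<close>: the functions which are regular and do not vanish there.\<close>

definition unit_at :: "complex \<Rightarrow> mero \<Rightarrow> bool" where
  "unit_at z f \<longleftrightarrow> regular_at f z \<and> val f z \<noteq> 0"

lemma unit_at_cst: "unit_at z (cst c) \<longleftrightarrow> c \<noteq> 0"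
  by (simp add: unit_at_def)

lemma unit_at_1 [simp]: "unit_at z 1"
  by (simp add: unit_at_def)

lemma unit_at_mult: "unit_at z f \<Longrightarrow> unit_at z g \<Longrightarrow> unit_at z (f * g)"
  by (simp add: unit_at_def regular_mult)

lemma unit_at_inverse: "unit_at z f \<Longrightarrow> unit_at z (inverse f)"
  by (simp add: unit_at_def regular_inverse)

lemma val_mult_unit: "unit_at z f \<Longrightarrow> unit_at z g \<Longrightarrow> val (f * g) z = val f z * val g z"
  by (simp add: unit_at_def regular_mult)

lemma unit_at_power:
  assumes "unit_at z f"
  shows "unit_at z (f ^ n) \<and> val (f ^ n) z = val f z ^ n"
  by (induction n) (use assms in \<open>auto simp: unit_at_mult val_mult_unit\<close>)

lemma unit_at_power_int:
  assumes "unit_at z f"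
  shows "unit_at z (f powi n)" "val (f powi n) z = val f z powi n"
  using unit_at_power[OF assms] unit_at_power[OF unit_at_inverse[OF assms]]
  by (auto simp: power_int_def unit_at_inverse)

lemma cst_0 [simp]: "cst 0 = 0" and cst_1 [simp]: "cst 1 = 1"
  by (simp_all add: zero_mero_def one_mero_def)

lemma cst_mult: "cst (a * b) = cst a * cst b"
proof (rule mero_eqI)
  show "\<forall>\<^sub>F w in at z. val (cst (a * b)) w = val (cst a * cst b) w" for z
    using val_mult[of "cst a" "cst b" z] by eventually_elim simp
qed

lemma cst_inject [simp]: "cst a = cst b \<longleftrightarrow> a = b"
  by (metis val_cst)

lemma cst_eq_0 [simp]: "cst a = 0 \<longleftrightarrow> a = 0"
  using cst_inject[of a 0] by (simp del: cst_inject)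

lemma dlog_mult:
  assumes f: "unit_at z f" and g: "unit_at z g"
  shows "dlog (f * g) z = dlog f z + dlog g z"
proof -
  have "eventually (\<lambda>w. val (f * g) w = val f w * val g w) (nhds z)"
    by (simp add: eventually_nhds_conv_at val_mult val_mult_unit[OF f g])
  then have "deriv (val (f * g)) z = deriv (\<lambda>w. val f w * val g w) z"
    by (intro deriv_cong_ev) auto
  also have "\<dots> = val f z * deriv (val g) z + deriv (val f) z * val g z"
    using f g by (intro deriv_mult)
      (auto simp: unit_at_def regular_at_def analytic_on_imp_differentiable_at)
  finally show ?thesis
    using f g by (simp add: dlog_def val_mult_unit[OF f g]) (simp add: unit_at_def field_simps)
qed

lemma dlog_1 [simp]: "dlog 1 z = 0" and dlog_cst [simp]: "dlog (cst c) z = 0"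
  by (simp_all add: dlog_def)

lemma dlog_inverse:
  assumes "unit_at z f" shows "dlog (inverse f) z = - dlog f z"
proof -
  have "f \<noteq> 0" using assms by (auto simp: unit_at_def)
  then have "f * inverse f = 1" by simp
  then have "dlog f z + dlog (inverse f) z = 0"
    using dlog_mult[OF assms unit_at_inverse[OF assms]] by simp
  then show ?thesis by (simp add: add_eq_0_iff)
qed

lemma dlog_power:
  assumes "unit_at z f" shows "dlog (f ^ n) z = of_nat n * dlog f z"
  by (induction n) (use assms in \<open>auto simp: unit_at_power dlog_mult algebra_simps\<close>)

lemma dlog_power_int:
  assumes "unit_at z f" shows "dlog (f powi n) z = of_int n * dlog f z"
  using dlog_power[OF assms] dlog_power[OF unit_at_inverse[OF assms]] dlog_inverse[OF assms]
  by (auto simp: power_int_def)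

lemma dlog_cst_mult: "t \<noteq> 0 \<Longrightarrow> unit_at z f \<Longrightarrow> dlog (cst t * f) z = dlog f z"
  by (simp add: dlog_mult unit_at_cst)

section \<open>The order of a section at the marked point\<close>

lemma residue_plus_meromorphic:
  assumes "f meromorphic_on {z}" "g meromorphic_on {z}"
  shows "residue (\<lambda>w. f w + g w) z = residue f z + residue g z"
proof -
  obtain F G where F: "(\<lambda>w. f (z + w)) has_laurent_expansion F"
    and G: "(\<lambda>w. g (z + w)) has_laurent_expansion G"
    using assms by (auto simp: meromorphic_on_def)
  have "residue (\<lambda>w. f w + g w) z = fls_residue (F + G)"
    by (rule has_laurent_expansion_residue) (rule has_laurent_expansion_add[OF F G])
  then show ?thesis
    by (simp add: has_laurent_expansion_residue[OF F] has_laurent_expansion_residue[OF G])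
qed

lemma residue_cmult_meromorphic:
  assumes "f meromorphic_on {z}"
  shows "residue (\<lambda>w. c * f w) z = c * residue f z"
proof -
  obtain F where F: "(\<lambda>w. f (z + w)) has_laurent_expansion F"
    using assms by (auto simp: meromorphic_on_def)
  have "residue (\<lambda>w. c * f w) z = fls_residue (fls_const c * F)"
    by (rule has_laurent_expansion_residue) (intro laurent_expansion_intros F)
  then show ?thesis
    by (simp add: has_laurent_expansion_residue[OF F])
qed

text \<open>
  Write \<open>f(w) = P(w) (w - z)\<^sup>n\<close> with \<open>P(z) \<noteq> 0\<close>. Then \<open>f'/f = P'/P + n/(w - z)\<close>, and the first
  summand is holomorphic at \<open>z\<close>.
\<close>

lemma residue_log_deriv:
  assumes "f meromorphic_on {z}" "\<exists>\<^sub>F w in at z. f w \<noteq> 0"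
  shows "residue (\<lambda>w. deriv f w / f w) z = of_int (zorder f z)"
proof -
  define n where "n = zorder f z"
  define P where "P = zor_poly f z"
  have "isolated_singularity_at f z" "not_essential f z"
    using assms(1) by (auto simp: meromorphic_at_iff)
  from zorder_exist[OF this assms(2)] obtain r where Pz: "P z \<noteq> 0" and r: "r > 0"
    and hol: "P holomorphic_on cball z r"
    and eq: "\<And>w. w \<in> cball z r - {z} \<Longrightarrow> f w = P w * (w - z) powi n \<and> P w \<noteq> 0"
    unfolding n_def P_def by blast
  have "eventually (\<lambda>w. w \<in> ball z r - {z}) (at z)"
    using r eventually_at_ball'[of r z UNIV] by auto
  then have "eventually (\<lambda>w. deriv f w / f w = deriv P w / P w + of_int n / (w - z)) (at z)"
  proof eventually_elim
    case (elim w)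
    have wz: "w \<noteq> z" using elim by auto
    have ev: "eventually (\<lambda>v. f v = P v * (v - z) powi n) (nhds w)"
      using eq by (intro eventually_mono[OF eventually_nhds_in_open[of "ball z r - {z}" w]])
        (use elim in auto)
    have "(P has_field_derivative deriv P w) (at w)"
      using elim by (intro holomorphic_derivI[OF holomorphic_on_subset[OF hol, of "ball z r"]]) auto
    then have "((\<lambda>v. P v * (v - z) powi n) has_field_derivative
        (deriv P w * (w - z) powi n + P w * (of_int n * (w - z) powi (n - 1)))) (at w)"
      using wz by (auto intro!: derivative_eq_intros)
    then have "deriv (\<lambda>v. P v * (v - z) powi n) w =
        deriv P w * (w - z) powi n + P w * (of_int n * (w - z) powi (n - 1))"
      by (rule DERIV_imp_deriv)
    moreover have "deriv f w = deriv (\<lambda>v. P v * (v - z) powi n) w"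
      by (rule deriv_cong_ev[OF ev]) simp
    moreover have "f w = P w * (w - z) powi n" "P w \<noteq> 0" using eq[of w] elim by auto
    moreover define Q where "Q = (w - z) powi n"
    moreover have "(w - z) powi (n - 1) = Q / (w - z)" "Q \<noteq> 0"
      using wz by (simp_all add: Q_def power_int_diff)
    ultimately have "deriv f w = deriv P w * Q + P w * (of_int n * (Q / (w - z)))"
      "f w = P w * Q" "P w \<noteq> 0" "Q \<noteq> 0" by simp_all
    then show ?case
      using wz by (simp add: add_divide_distrib)
  qed
  then have "residue (\<lambda>w. deriv f w / f w) z = residue (\<lambda>w. deriv P w / P w + of_int n / (w - z)) z"
    by (intro residue_cong) auto
  also have "\<dots> = residue (\<lambda>w. deriv P w / P w) z + residue (\<lambda>w. of_int n / (w - z)) z"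
  proof (rule residue_plus_meromorphic)
    have "P analytic_on {z}"
      using hol r by (meson analytic_at ball_subset_cball centre_in_ball holomorphic_on_subset open_ball)
    then show "(\<lambda>w. deriv P w / P w) meromorphic_on {z}"
      by (intro meromorphic_intros analytic_on_imp_meromorphic_on)
  qed (auto intro!: meromorphic_intros)
  also have "residue (\<lambda>w. deriv P w / P w) z = 0"
  proof (rule residue_holo[of "ball z r"])
    have "P w \<noteq> 0" if "w \<in> ball z r" for w
      using eq[of w] Pz that by (cases "w = z") auto
    then show "(\<lambda>w. deriv P w / P w) holomorphic_on ball z r"
      using hol by (intro holomorphic_intros holomorphic_deriv)
        (auto intro: holomorphic_on_subset)
  qed (use r in auto)
  also have "residue (\<lambda>w. of_int n / (w - z)) z = of_int n"
    using residue_simple[of UNIV z "\<lambda>_. of_int n"] by simp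
  finally show ?thesis by (simp add: n_def)
qed

text \<open>The order of vanishing at \<open>P\<close>; the value at \<open>0\<close> is of no significance.\<close>

definition degP :: "mero \<Rightarrow> int" where
  "degP f = zorder (\<lambda>w. val f (inverse w)) 0"

lemma eventually_nonzero_at_infinity:
  assumes "f \<noteq> 0"
  shows "eventually (\<lambda>w. val f w \<noteq> 0) at_infinity"
proof -
  have "f * inverse f = 1" using assms by simp
  then show ?thesis
    using val_mult_at_infinity[of f "inverse f"] by (auto elim: eventually_mono)
qed

lemma freq_nonzero_at_P:
  assumes "f \<noteq> 0"
  shows "\<exists>\<^sub>F w in at 0. val f (inverse w) \<noteq> 0"
  using eventually_nonzero_at_infinity[OF assms]
  by (intro eventually_frequently) (simp_all add: eventually_at_infinity_inverse)

lemma degP_mult: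
  assumes "f \<noteq> 0" "g \<noteq> 0"
  shows "degP (f * g) = degP f + degP g"
proof -
  have "degP (f * g) = zorder (\<lambda>w. val f (inverse w) * val g (inverse w)) 0"
    unfolding degP_def using val_mult_at_infinity[of f g]
    by (intro zorder_cong) (simp_all add: eventually_at_infinity_inverse)
  also have "\<dots> = degP f + degP g"
    unfolding degP_def using val_at_P freq_nonzero_at_P assms
    by (intro zorder_mult) (auto simp: meromorphic_at_P_def)
  finally show ?thesis .
qed

lemma degP_cst: "c \<noteq> 0 \<Longrightarrow> degP (cst c) = 0"
  unfolding degP_def by (intro zorder_eqI[of UNIV _ "\<lambda>_. c"]) auto

lemma degP_1 [simp]: "degP 1 = 0"
  using degP_cst[of 1] by simp

lemma degP_cst_mult: "c \<noteq> 0 \<Longrightarrow> f \<noteq> 0 \<Longrightarrow> degP (cst c * f) = degP f"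
  by (simp add: degP_mult degP_cst)

lemma degP_inverse: "f \<noteq> 0 \<Longrightarrow> degP (inverse f) = - degP f"
  using degP_mult[of f "inverse f"] by simp

lemma degP_power: "f \<noteq> 0 \<Longrightarrow> degP (f ^ n) = int n * degP f"
  by (induction n) (auto simp: degP_mult algebra_simps)

lemma degP_power_int: "f \<noteq> 0 \<Longrightarrow> degP (f powi n) = n * degP f"
  by (auto simp: power_int_def degP_power degP_inverse)

text \<open>
  In the local parameter \<open>w = 1/x\<close> the form \<open>dlog f dx\<close> is the logarithmic derivative of \<open>f(1/w)\<close>
  times \<open>dw\<close>, so its residue is the order of \<open>f\<close> at \<open>P\<close>.
\<close>

lemma residue_P_dlog:
  assumes "f \<noteq> 0"
  shows "residue_P (dlog f) = of_int (degP f)"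
proof -
  let ?k = "\<lambda>w. val f (inverse w)"
  have mer: "?k meromorphic_on {0}"
    using val_at_P by (simp add: meromorphic_at_P_def)
  then have "isolated_singularity_at ?k 0"
    by (auto simp: meromorphic_at_iff)
  then have "eventually (\<lambda>w. ?k analytic_on {w}) (at 0)"
    using isolated_singularity_at_altdef by blast
  moreover have "eventually (\<lambda>w. w \<noteq> (0::complex)) (at 0)"
    by (simp add: eventually_at_filter)
  ultimately have "eventually (\<lambda>w. - dlog f (inverse w) / w ^ 2 = deriv ?k w / ?k w) (at 0)"
  proof eventually_elim
    case (elim w)
    have "(?k \<circ> inverse) analytic_on {inverse w}"
      by (rule analytic_on_compose) (use elim in \<open>auto intro!: analytic_intros\<close>)
    then have "val f analytic_on {inverse w}"
      by (simp add: o_def)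
    then have d: "(val f has_field_derivative deriv (val f) (inverse w)) (at (inverse w))"
      by (simp add: analytic_on_imp_differentiable_at DERIV_deriv_iff_field_differentiable)
    have "(?k has_field_derivative deriv (val f) (inverse w) * (- (inverse w ^ Suc (Suc 0)))) (at w)"
      by (rule DERIV_chain2[OF d DERIV_inverse]) (use elim in auto)
    from DERIV_imp_deriv[OF this]
    have "deriv ?k w = - deriv (val f) (inverse w) / w ^ 2"
      using elim by (simp add: power2_eq_square divide_inverse)
    then show ?case
      by (simp add: dlog_def)
  qed
  then have "residue_P (dlog f) = residue (\<lambda>w. deriv ?k w / ?k w) 0"
    unfolding residue_P_def by (intro residue_cong) auto
  also have "\<dots> = of_int (degP f)"
    unfolding degP_def by (rule residue_log_deriv[OF mer freq_nonzero_at_P[OF assms]])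
  finally show ?thesis .
qed

lemma Ksec_iff: "\<sigma> \<in> Ksec A l \<longleftrightarrow> \<sigma> \<noteq> 0 \<and> degP \<sigma> = l \<and> (\<forall>z\<in>A. unit_at z \<sigma>)"
  by (auto simp: Ksec_def residue_P_dlog unit_at_def)

section \<open>Coordinates\<close>

text \<open>
  A coordinate is entire and grows at most linearly, because its pole at \<open>P\<close> is simple;
  Liouville's theorem then makes it a polynomial of degree one.
\<close>

lemma coordinate_affine:
  assumes "coordinate u"
  obtains a b where "a \<noteq> 0" "val u = (\<lambda>w. a * w + b)"
proof -
  let ?k = "\<lambda>w. val u (inverse w)"
  have reg: "\<And>z. regular_at u z" and pole: "is_pole ?k 0" and ord: "zorder ?k 0 = -1"
    using assms by (auto simp: coordinate_def)
  have mer: "?k meromorphic_on {0}"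
    using val_at_P by (simp add: meromorphic_at_P_def)
  have hol: "val u holomorphic_on UNIV"
    using reg unfolding regular_at_def
    by (metis analytic_imp_holomorphic analytic_on_analytic_at)
  have "u \<noteq> 0"
  proof
    assume "u = 0"
    then have "is_pole (\<lambda>_::complex. 0 :: complex) 0" using pole by simp
    then show False by (simp add: not_is_pole_const)
  qed
  from freq_nonzero_at_P[OF this] mer obtain r where r: "r > 0"
    and holg: "zor_poly ?k 0 holomorphic_on cball 0 r"
    and eq: "\<And>w. w \<in> cball 0 r - {0} \<Longrightarrow> ?k w = zor_poly ?k 0 w * w powi (-1)"
    using zorder_exist[of ?k 0] ord by (auto simp: meromorphic_at_iff)
  have "continuous_on (cball 0 r) (zor_poly ?k 0)"
    using holg by (rule holomorphic_on_imp_continuous_on)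
  then have "bounded (zor_poly ?k 0 ` cball 0 r)"
    by (intro compact_imp_bounded compact_continuous_image) auto
  then obtain B where B: "\<And>w. w \<in> cball 0 r \<Longrightarrow> norm (zor_poly ?k 0 w) \<le> B"
    unfolding bounded_iff by blast
  have growth: "norm (val u w) \<le> B * norm w ^ 1" if "norm w \<ge> 1 / r" for w
  proof -
    have w: "w \<noteq> 0" using that r by auto
    have "inverse (norm w) \<le> inverse (1 / r)"
      using that r by (intro le_imp_inverse_le) auto
    then have "norm (inverse w) \<le> r" unfolding norm_inverse by simp
    then have i: "inverse w \<in> cball 0 r - {0}"
      using w by simp
    have "val u w = zor_poly ?k 0 (inverse w) * w"
      using eq[OF i] by (simp only: inverse_inverse_eq power_int_minus1_right)
    then show ?thesis using B[of "inverse w"] i by (simp add: norm_mult mult_right_mono)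
  qed
  define a where "a = deriv (val u) 0"
  define b where "b = val u 0"
  have lin: "val u = (\<lambda>w. a * w + b)"
  proof
    fix w
    have "val u w = (\<Sum>k\<le>1. (deriv ^^ k) (val u) 0 / fact k * w ^ k)"
      by (rule Liouville_polynomial[OF hol growth])
    also have "\<dots> = a * w + b" by (simp add: a_def b_def)
    finally show "val u w = a * w + b" .
  qed
  have "a \<noteq> 0"
  proof
    assume "a = 0"
    then have "is_pole (\<lambda>_::complex. b) 0" using pole lin by simp
    then show False by (simp add: not_is_pole_const)
  qed
  with lin that show ?thesis by blast
qed

lemma val_coordinate_minus:
  assumes "val u = (\<lambda>w. a * w + b)"
  shows "val (u - cst (val u z)) = (\<lambda>w. a * (w - z))" "regular_at (u - cst (val u z)) w"
proof -
  have reg: "regular_at u v" for v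
    using assms by (auto simp: regular_at_def intro!: analytic_intros)
  show "val (u - cst (val u z)) = (\<lambda>w. a * (w - z))"
    by (simp add: fun_eq_iff regular_diff reg assms algebra_simps)
  show "regular_at (u - cst (val u z)) w"
    by (simp add: regular_diff reg)
qed

lemma degP_coordinate_minus:
  assumes "val u = (\<lambda>w. a * w + b)" "a \<noteq> 0"
  shows "degP (u - cst (val u z)) = -1"
  unfolding degP_def val_coordinate_minus[OF assms(1)]
proof (rule zorder_eqI[of UNIV _ "\<lambda>w. a * (1 - z * w)"])
  show "(\<lambda>w. a * (1 - z * w)) holomorphic_on UNIV" by (intro holomorphic_intros)
qed (use assms(2) in \<open>auto simp: power_int_minus field_simps\<close>)

lemma coordinate_d_at:
  assumes "coordinate u"
  shows "d_at u z \<noteq> 0" "d_at u z = d_at u z'"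
    "val (u - cst (val u z)) = (\<lambda>w. d_at u z * (w - z))"
    "regular_at (u - cst (val u z)) w" "degP (u - cst (val u z)) = -1"
proof -
  obtain a b where a: "a \<noteq> 0" and u: "val u = (\<lambda>w. a * w + b)"
    using coordinate_affine[OF assms] by blast
  have d: "d_at u v = a" for v
    unfolding d_at_def u by (rule DERIV_imp_deriv) (auto intro!: derivative_eq_intros)
  show "d_at u z \<noteq> 0" "d_at u z = d_at u z'" using a by (simp_all add: d)
  show "val (u - cst (val u z)) = (\<lambda>w. d_at u z * (w - z))" "regular_at (u - cst (val u z)) w"
    unfolding d by (rule val_coordinate_minus[OF u])+
  show "degP (u - cst (val u z)) = -1" by (rule degP_coordinate_minus[OF u a])
qed

lemma coordinate_minus_nonzero:
  assumes "coordinate u" shows "u - cst (val u z) \<noteq> 0"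
proof
  assume "u - cst (val u z) = 0"
  then have "val (u - cst (val u z)) (z + 1) = 0" by simp
  then show False using coordinate_d_at(1,3)[OF assms, of z] by simp
qed

lemma unit_at_coordinate_minus:
  "coordinate u \<Longrightarrow> w \<noteq> z \<Longrightarrow> unit_at w (u - cst (val u z))"
  using coordinate_d_at(1,3,4)[of u z] by (simp add: unit_at_def)

lemma dlog_coordinate_minus:
  assumes "coordinate u" "w \<noteq> z"
  shows "dlog (u - cst (val u z)) w = 1 / (w - z)"
proof -
  have "deriv (\<lambda>w. d_at u z * (w - z)) w = d_at u z"
    by (rule DERIV_imp_deriv) (auto intro!: derivative_eq_intros)
  then show ?thesis
    using coordinate_d_at(1,3)[OF assms(1), of z] by (simp add: dlog_def)
qed

text \<open>The function \<open>1/(u - u(z))\<close> vanishes at \<open>P\<close>, so it is an element of \<open>\<mm>\<^sub>P\<close>.\<close>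

lemma fun_of_eps:
  assumes "coordinate u"
  shows "fun_of (Abs_mP (1 / (u - cst (val u z)))) = inverse (u - cst (val u z))"
proof -
  let ?f = "inverse (u - cst (val u z))"
  have "filterlim (\<lambda>w. w - z) at_infinity at_infinity"
    using tendsto_add_filterlim_at_infinity[of "\<lambda>_. - z" "- z" at_infinity "\<lambda>w. w"]
    by (simp add: filterlim_ident)
  then have "filterlim (\<lambda>w. d_at u z * (w - z)) at_infinity at_infinity"
    using coordinate_d_at(1)[OF assms]
    by (intro tendsto_mult_filterlim_at_infinity[of _ "d_at u z"]) auto
  then have "((\<lambda>w. inverse (d_at u z * (w - z))) \<longlongrightarrow> 0) at_infinity"
    by (rule filterlim_compose[OF tendsto_inverse_0])
  then have "vanishes_at_P ?f"
    by (simp add: vanishes_at_P_def coordinate_d_at(3)[OF assms])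
  then have "fun_of (Abs_mP ?f) = ?f" by (simp add: Abs_mP_inverse)
  then show ?thesis by (simp add: divide_inverse)
qed

lemma coordinate_power:
  assumes "coordinate u"
  shows "(u - cst (val u z)) powi k \<noteq> 0" "degP ((u - cst (val u z)) powi k) = - k"
    "w \<noteq> z \<Longrightarrow> unit_at w ((u - cst (val u z)) powi k)"
    "w \<noteq> z \<Longrightarrow> val ((u - cst (val u z)) powi k) w = (d_at u z * (w - z)) powi k"
    "w \<noteq> z \<Longrightarrow> dlog ((u - cst (val u z)) powi k) w = of_int k / (w - z)"
proof -
  note nz = coordinate_minus_nonzero[OF assms, of z]
  show "(u - cst (val u z)) powi k \<noteq> 0" using nz by simp
  show "degP ((u - cst (val u z)) powi k) = - k"
    by (simp add: degP_power_int[OF nz] coordinate_d_at(5)[OF assms])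
  assume "w \<noteq> z"
  note unit = unit_at_coordinate_minus[OF assms this]
  show "unit_at w ((u - cst (val u z)) powi k)" by (rule unit_at_power_int(1)[OF unit])
  show "val ((u - cst (val u z)) powi k) w = (d_at u z * (w - z)) powi k"
    by (simp add: unit_at_power_int(2)[OF unit] coordinate_d_at(3)[OF assms])
  show "dlog ((u - cst (val u z)) powi k) w = of_int k / (w - z)"
    by (simp add: dlog_power_int[OF unit] dlog_coordinate_minus[OF assms \<open>w \<noteq> z\<close>])
qed

section \<open>Laurent coefficients\<close>

text \<open>
  The coefficient of \<open>(x - z)\<^sup>n\<close> in the Laurent expansion of \<open>f\<close> at \<open>z\<close>. For \<open>n = 0\<close> and
  \<open>n = 1\<close> it extends the linear functionals \<open>f \<mapsto> f(z)\<close> and \<open>f \<mapsto> f'(z)\<close> from the functions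
  regular at \<open>z\<close> to all meromorphic functions. Operators on the symmetric algebra of \<open>\<mm>\<^sub>P\<close> can
  thus be defined on the whole algebra, although only their restriction to functions regular at
  \<open>z\<close> matters.
\<close>

definition laurent_coeff :: "nat \<Rightarrow> complex \<Rightarrow> mero \<Rightarrow> complex" where
  "laurent_coeff n z f = residue (\<lambda>w. val f w / (w - z) ^ Suc n) z"

lemma laurent_coeff_add: "laurent_coeff n z (f + g) = laurent_coeff n z f + laurent_coeff n z g"
proof -
  have "laurent_coeff n z (f + g) = residue (\<lambda>w. val f w / (w - z) ^ Suc n + val g w / (w - z) ^ Suc n) z"
    unfolding laurent_coeff_def
    by (rule residue_cong[OF eventually_mono[OF val_add[of f g z]]]) (simp_all add: add_divide_distrib)
  then show ?thesis
    unfolding laurent_coeff_def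
    by (subst (asm) residue_plus_meromorphic) (auto intro!: meromorphic_intros val_mero)
qed

lemma laurent_coeff_cst_mult: "laurent_coeff n z (cst c * f) = c * laurent_coeff n z f"
proof -
  have "laurent_coeff n z (cst c * f) = residue (\<lambda>w. c * (val f w / (w - z) ^ Suc n)) z"
    unfolding laurent_coeff_def
    by (rule residue_cong[OF eventually_mono[OF val_mult[of "cst c" f z]]]) simp_all
  then show ?thesis
    unfolding laurent_coeff_def
    by (subst (asm) residue_cmult_meromorphic) (auto intro!: meromorphic_intros val_mero)
qed

lemma laurent_coeff_regular:
  assumes "regular_at f z"
  shows "laurent_coeff n z f = (deriv ^^ n) (val f) z / fact n"
proof -
  obtain S where "open S" "z \<in> S" "val f holomorphic_on S"
    using assms by (auto simp: regular_at_def analytic_at)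
  then show ?thesis
    unfolding laurent_coeff_def by (rule residue_holomorphic_over_power)
qed

section \<open>The universal property of the symmetric algebra\<close>

lemma sconst_add: "sconst (a + b) = sconst a + sconst b"
  by transfer (simp add: free_const_def single_add lin_rel_def ideal_zero)

lemma sconst_mult: "sconst (a * b) = sconst a * sconst b"
  by transfer (simp add: free_const_def mult_single lin_rel_def ideal_zero)

lemma free_const_1: "free_const 1 = 1"
  unfolding free_const_def zero_multiset_def[symmetric] by simp

lemma sconst_0 [simp]: "sconst 0 = 0"
  by transfer (simp add: free_const_def lin_rel_def ideal_zero)

lemma sconst_1 [simp]: "sconst 1 = 1"
  by transfer (simp add: free_const_1 lin_rel_def ideal_zero)

lemma sconst_uminus: "sconst (- a) = - sconst a"
  using sconst_add[of a "- a"] by (simp add: eq_neg_iff_add_eq_0 add.commute)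

lemma sconst_diff: "sconst (a - b) = sconst a - sconst b"
  using sconst_add[of a "- b"] by (simp add: sconst_uminus)

lemma sgen_add: "sgen (a + b) = sgen a + sgen b"
  by transfer (use ideal_add_rel in \<open>simp add: lin_rel_def diff_diff_eq\<close>)

lemma sgen_scale: "sgen (scale_mP c a) = sconst c * sgen a"
  by transfer (simp add: lin_rel_def ideal_scale_rel)

text \<open>
  The algebra homomorphism from the polynomial algebra to \<open>'r\<close> which is \<open>c\<close> on scalars and sends
  the variable of \<open>a \<in> \<mm>\<^sub>P\<close> to \<open>g a\<close>, and the map that it induces on the symmetric algebra.
  The induced map is given by a choice of representatives; it has a meaning if \<open>c\<close> is a ring
  homomorphism and \<open>g\<close> is linear over it.
\<close>

definition free_eval :: "(complex \<Rightarrow> 'r) \<Rightarrow> (mP \<Rightarrow> 'r) \<Rightarrow> free_alg \<Rightarrow> 'r :: comm_ring_1" where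
  "free_eval c g p =
     (\<Sum>m\<in>Poly_Mapping.keys p. c (Poly_Mapping.lookup p m) * prod_mset (image_mset g m))"

definition sym_eval :: "(complex \<Rightarrow> 'r) \<Rightarrow> (mP \<Rightarrow> 'r) \<Rightarrow> symalg \<Rightarrow> 'r :: comm_ring_1" where
  "sym_eval c g v = free_eval c g (rep_symalg v)"

lemma free_alg_induct:
  assumes "P 0" "\<And>m x. P (Poly_Mapping.single m x)" "\<And>p q. P p \<Longrightarrow> P q \<Longrightarrow> P (p + q)"
  shows "P (p :: free_alg)"
proof (induction p rule: update_induct)
  case (update f a b)
  have "Poly_Mapping.update a b f = f + Poly_Mapping.single a b"
    using update(1)
    by (intro poly_mapping_eqI) (auto simp: lookup_update lookup_add lookup_single in_keys_iff when_def)
  then show ?case using assms update by simp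
qed (rule assms(1))

text \<open>
  The data of a \<open>\<complex>\<close>-algebra, with structure map \<open>c\<close>, and of a linear map \<open>g\<close> from \<open>\<mm>\<^sub>P\<close> to it. They
  induce an algebra homomorphism on the symmetric algebra.
\<close>

locale sym_target =
  fixes c :: "complex \<Rightarrow> 'r :: comm_ring_1" and g :: "mP \<Rightarrow> 'r"
  assumes c_0: "c 0 = 0" and c_1: "c 1 = 1"
    and c_add: "c (x + y) = c x + c y" and c_mult: "c (x * y) = c x * c y"
    and g_add: "g (a + b) = g a + g b" and g_scale: "g (scale_mP x a) = c x * g a"
begin

abbreviation "fe \<equiv> free_eval c g"

lemma free_eval_add: "fe (p + q) = fe p + fe q"
  unfolding free_eval_def
  by (rule setsum_keys_plus_distrib) (simp_all add: c_0 c_add algebra_simps)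

lemma free_eval_0: "fe 0 = 0"
  by (simp add: free_eval_def)

lemma free_eval_uminus: "fe (- p) = - fe p"
  using free_eval_add[of p "- p"] by (simp add: free_eval_0 eq_neg_iff_add_eq_0 add.commute)

lemma free_eval_diff: "fe (p - q) = fe p - fe q"
  using free_eval_add[of p "- q"] by (simp add: free_eval_uminus)

lemma free_eval_single: "fe (Poly_Mapping.single m x) = c x * prod_mset (image_mset g m)"
  by (simp add: free_eval_def c_0)

lemma free_eval_mult: "fe (p * q) = fe p * fe q"
proof (induction p rule: free_alg_induct)
  case (2 m x)
  show ?case
  proof (induction q rule: free_alg_induct)
    case (2 n y)
    show ?case by (simp add: mult_single free_eval_single c_mult mult_ac)
  qed (simp_all add: free_eval_0 free_eval_add distrib_left)
qed (simp_all add: free_eval_0 free_eval_add distrib_right)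

lemma free_eval_const: "fe (free_const x) = c x"
  by (simp add: free_const_def free_eval_single)

lemma free_eval_var: "fe (free_var a) = g a"
  by (simp add: free_var_def free_eval_single c_1)

lemma free_eval_ideal: "p \<in> lin_ideal \<Longrightarrow> fe p = 0"
  by (induction rule: lin_ideal.induct)
     (simp_all add: free_eval_add free_eval_diff free_eval_mult free_eval_0 free_eval_const
       free_eval_var g_add g_scale)

lemma sym_eval_abs: "sym_eval c g (abs_symalg p) = fe p"
proof -
  have "lin_rel (rep_symalg (abs_symalg p)) p"
    using Quotient3_rep_abs[OF Quotient3_symalg, of p]
    by (simp add: lin_rel_def ideal_zero)
  then show ?thesis
    using free_eval_ideal[of "rep_symalg (abs_symalg p) - p"]
    by (simp add: sym_eval_def lin_rel_def free_eval_diff)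
qed

lemma sym_eval_const: "sym_eval c g (sconst x) = c x"
  by (simp add: sconst.abs_eq sym_eval_abs free_eval_const)

lemma sym_eval_gen: "sym_eval c g (sgen a) = g a"
  by (simp add: sgen.abs_eq sym_eval_abs free_eval_var)

lemma sym_eval_add: "sym_eval c g (v + w) = sym_eval c g v + sym_eval c g w"
proof -
  obtain p q where "v = abs_symalg p" "w = abs_symalg q"
    using Quotient3_abs_rep[OF Quotient3_symalg] by metis
  then show ?thesis by (simp add: plus_symalg.abs_eq sym_eval_abs free_eval_add)
qed

lemma sym_eval_mult: "sym_eval c g (v * w) = sym_eval c g v * sym_eval c g w"
proof -
  obtain p q where "v = abs_symalg p" "w = abs_symalg q"
    using Quotient3_abs_rep[OF Quotient3_symalg] by metis
  then show ?thesis by (simp add: times_symalg.abs_eq sym_eval_abs free_eval_mult)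
qed

end

lemma Wsub_mono: "v \<in> Wsub A \<Longrightarrow> B \<subseteq> A \<Longrightarrow> v \<in> Wsub B"
  by (induction rule: Wsub.induct) (auto intro: Wsub.intros)

lemma Wsub_UNIV: "Wsub {} = UNIV"
proof -
  have "v \<in> Wsub {}" for v
  proof -
    obtain p where v: "v = abs_symalg p"
      using Quotient3_abs_rep[OF Quotient3_symalg] by metis
    have gens: "abs_symalg (Poly_Mapping.single m x) \<in> Wsub {}" for m x
    proof (induction m)
      case empty
      show ?case
        using Wsub_const[of x "{}"] by (simp add: sconst.abs_eq free_const_def)
    next
      case (add b m)
      have "abs_symalg (Poly_Mapping.single (add_mset b m) x) =
          sgen b * abs_symalg (Poly_Mapping.single m x)"
        by (simp add: sgen.abs_eq times_symalg.abs_eq free_var_def mult_single)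
      then show ?case using add by (auto intro: Wsub.intros)
    qed
    have "abs_symalg p \<in> Wsub {}"
    proof (induction p rule: free_alg_induct)
      case 1
      show ?case using Wsub_const[of 0 "{}"] by (simp add: zero_symalg.abs_eq[symmetric])
    next
      case (2 m x) show ?case by (rule gens)
    next
      case (3 p q)
      then have "abs_symalg p + abs_symalg q \<in> Wsub {}" by (rule Wsub_add)
      then show ?case by (simp add: plus_symalg.abs_eq)
    qed
    then show ?thesis by (simp add: v)
  qed
  then show ?thesis by auto
qed

lemma symalg_induct [case_names const gen add mult]:
  assumes "\<And>x. P (sconst x)" "\<And>b. P (sgen b)"
    "\<And>v w. P v \<Longrightarrow> P w \<Longrightarrow> P (v + w)" "\<And>v w. P v \<Longrightarrow> P w \<Longrightarrow> P (v * w)"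
  shows "P v"
proof -
  have "v \<in> Wsub {}" by (simp add: Wsub_UNIV)
  then show ?thesis by induction (use assms in auto)
qed

section \<open>Translations and derivations of the symmetric algebra\<close>

text \<open>The Laurent coefficients as linear functionals on \<open>\<mm>\<^sub>P\<close>.\<close>

abbreviation coeff_mP :: "nat \<Rightarrow> complex \<Rightarrow> mP \<Rightarrow> complex" where
  "coeff_mP n z b \<equiv> laurent_coeff n z (fun_of b)"

lemma coeff_mP_regular:
  assumes "regular_at (fun_of b) z"
  shows "coeff_mP 0 z b = val (fun_of b) z" "coeff_mP 1 z b = d_at (fun_of b) z"
  using assms by (simp_all add: laurent_coeff_regular d_at_def)

text \<open>
  The algebra endomorphism sending a generator \<open>b\<close> to \<open>b + \<mu> b(z)\<close>, where \<open>b(z)\<close> stands for the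
  Laurent coefficient of degree \<open>0\<close>.
\<close>

definition translate :: "complex \<Rightarrow> complex \<Rightarrow> symalg \<Rightarrow> symalg" where
  "translate \<mu> z = sym_eval sconst (\<lambda>b. sgen b + sconst (\<mu> * coeff_mP 0 z b))"

lemma sym_target_translate: "sym_target sconst (\<lambda>b. sgen b + sconst (\<mu> * coeff_mP 0 z b))"
  by unfold_locales
    (simp_all add: sconst_add sconst_mult sgen_add sgen_scale plus_mP.rep_eq scale_mP.rep_eq
      laurent_coeff_add laurent_coeff_cst_mult algebra_simps)

lemma translate_const [simp]: "translate \<mu> z (sconst x) = sconst x"
  and translate_gen: "translate \<mu> z (sgen b) = sgen b + sconst (\<mu> * coeff_mP 0 z b)"
  and translate_add: "translate \<mu> z (v + w) = translate \<mu> z v + translate \<mu> z w"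
  and translate_mult: "translate \<mu> z (v * w) = translate \<mu> z v * translate \<mu> z w"
  unfolding translate_def
  by (rule sym_target.sym_eval_const[OF sym_target_translate] sym_target.sym_eval_gen[OF sym_target_translate]
      sym_target.sym_eval_add[OF sym_target_translate] sym_target.sym_eval_mult[OF sym_target_translate])+

text \<open>
  The homomorphism \<open>b \<mapsto> b - b'(z) X\<close> to polynomials in \<open>X\<close> over the symmetric algebra, where
  \<open>b'(z)\<close> stands for the Laurent coefficient of degree \<open>1\<close>. Its value at \<open>v\<close> has constant term
  \<open>v\<close>, so that its linear term is a derivation.
\<close>

definition dual_eval :: "complex \<Rightarrow> symalg \<Rightarrow> symalg poly" where
  "dual_eval z = sym_eval (\<lambda>x. [:sconst x:]) (\<lambda>b. [:sgen b, sconst (- coeff_mP 1 z b):])"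

lemma sym_target_dual: "sym_target (\<lambda>x. [:sconst x:]) (\<lambda>b. [:sgen b, sconst (- coeff_mP 1 z b):])"
  by unfold_locales
    (simp_all add: sconst_add sconst_mult sconst_uminus sconst_diff sgen_add sgen_scale plus_mP.rep_eq
      scale_mP.rep_eq laurent_coeff_add laurent_coeff_cst_mult algebra_simps one_pCons)

lemmas dual_const = sym_target.sym_eval_const[OF sym_target_dual, folded dual_eval_def]
  and dual_gen = sym_target.sym_eval_gen[OF sym_target_dual, folded dual_eval_def]
  and dual_add = sym_target.sym_eval_add[OF sym_target_dual, folded dual_eval_def]
  and dual_mult = sym_target.sym_eval_mult[OF sym_target_dual, folded dual_eval_def]

text \<open>The derivation sending a generator \<open>b\<close> to the scalar \<open>- b'(z)\<close>, in the same sense.\<close>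

definition sderiv :: "complex \<Rightarrow> symalg \<Rightarrow> symalg" where
  "sderiv z v = coeff (dual_eval z v) 1"

lemma sderiv_const [simp]: "sderiv z (sconst x) = 0"
  by (simp add: sderiv_def dual_const)

lemma sderiv_gen: "sderiv z (sgen b) = sconst (- coeff_mP 1 z b)"
  by (simp add: sderiv_def dual_gen)

lemma sderiv_add: "sderiv z (v + w) = sderiv z v + sderiv z w"
  by (simp add: sderiv_def dual_add)

lemma coeff_0_dual: "coeff (dual_eval z v) 0 = v"
  by (induction v rule: symalg_induct)
    (simp_all add: dual_const dual_gen dual_add dual_mult coeff_mult)

lemma sderiv_mult: "sderiv z (v * w) = sderiv z v * w + v * sderiv z w"
  by (simp add: sderiv_def dual_mult coeff_mult coeff_0_dual)

lemma translate_0 [simp]: "translate \<mu> z 0 = 0" and translate_1 [simp]: "translate \<mu> z 1 = 1"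
  using translate_const[of \<mu> z 0] translate_const[of \<mu> z 1] by (simp_all del: translate_const)

lemma sderiv_0 [simp]: "sderiv z 0 = 0" and sderiv_1 [simp]: "sderiv z 1 = 0"
  using sderiv_const[of z 0] sderiv_const[of z 1] by (simp_all del: sderiv_const)

lemma sderiv_translate: "sderiv z' (translate \<mu> z v) = translate \<mu> z (sderiv z' v)"
  by (induction v rule: symalg_induct)
    (simp_all add: translate_gen sderiv_gen sderiv_add translate_add sderiv_mult translate_mult)

lemma translate_commute: "translate \<mu>' z' (translate \<mu> z v) = translate \<mu> z (translate \<mu>' z' v)"
proof (induction v rule: symalg_induct)
  case (gen b)
  show ?case by (simp add: translate_gen translate_add add_ac)
qed (simp_all only: translate_add translate_mult translate_const)

lemma translate_Wsub: "v \<in> Wsub A \<Longrightarrow> translate \<mu> z v \<in> Wsub A"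
  by (induction rule: Wsub.induct) (auto simp: translate_gen translate_add translate_mult intro: Wsub.intros)

lemma Wsub_0 [simp]: "0 \<in> Wsub A" and Wsub_1 [simp]: "1 \<in> Wsub A"
  using Wsub_const[of 0 A] Wsub_const[of 1 A] by simp_all

lemma Wsub_uminus: "v \<in> Wsub A \<Longrightarrow> - v \<in> Wsub A"
  using Wsub_mult[OF Wsub_const[of "-1"], of v A] by (simp add: sconst_uminus)

lemma Wsub_diff: "v \<in> Wsub A \<Longrightarrow> w \<in> Wsub A \<Longrightarrow> v - w \<in> Wsub A"
  using Wsub_add[of v A "- w"] by (simp add: Wsub_uminus)

lemma sderiv_Wsub: "v \<in> Wsub A \<Longrightarrow> sderiv z v \<in> Wsub A"
proof (induction rule: Wsub.induct)
  case (Wsub_const c)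
  then show ?case using Wsub.Wsub_const[of 0] by simp
qed (auto simp: sderiv_gen sderiv_add sderiv_mult intro: Wsub.intros)

section \<open>The space of states\<close>

lemma orbit_refl: "\<sigma> \<in> orbit \<sigma>"
  unfolding orbit_def by (auto intro!: exI[of _ 1])

lemma orbit_trans:
  assumes "\<tau> \<in> orbit \<sigma>" "\<upsilon> \<in> orbit \<tau>" shows "\<upsilon> \<in> orbit \<sigma>"
proof -
  obtain s t where "s \<noteq> 0" "t \<noteq> 0" "\<tau> = cst s * \<sigma>" "\<upsilon> = cst t * \<tau>"
    using assms by (auto simp: orbit_def)
  then show ?thesis
    by (auto simp: orbit_def cst_mult mult.assoc intro!: exI[of _ "t * s"])
qed

lemma orbit_sym:
  assumes "\<tau> \<in> orbit \<sigma>" shows "\<sigma> \<in> orbit \<tau>"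
proof -
  obtain s where "s \<noteq> 0" "\<tau> = cst s * \<sigma>"
    using assms by (auto simp: orbit_def)
  then show ?thesis
    by (auto simp: orbit_def cst_mult[symmetric] mult.assoc[symmetric] intro!: exI[of _ "inverse s"])
qed

lemma orbit_eq_iff: "orbit \<tau> = orbit \<sigma> \<longleftrightarrow> \<tau> \<in> orbit \<sigma>"
  using orbit_refl orbit_sym orbit_trans by blast

lemma orbit_mult_iff:
  assumes "g \<noteq> 0" shows "g * \<tau> \<in> orbit (g * \<sigma>) \<longleftrightarrow> \<tau> \<in> orbit \<sigma>"
proof -
  have "g * \<tau> = cst t * (g * \<sigma>) \<longleftrightarrow> \<tau> = cst t * \<sigma>" for t
    using assms by (simp add: mult.left_commute)
  then show ?thesis by (simp add: orbit_def)
qed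

lemma orbit_cst_mult_iff:
  assumes "t \<noteq> 0" shows "cst t * \<tau> \<in> orbit \<sigma> \<longleftrightarrow> \<tau> \<in> orbit \<sigma>"
proof -
  have "cst t * \<tau> \<in> orbit \<tau>" using assms by (auto simp: orbit_def)
  then show ?thesis using orbit_sym orbit_trans by blast
qed

lemma degP_orbit: "\<tau> \<in> orbit \<sigma> \<Longrightarrow> \<sigma> \<noteq> 0 \<Longrightarrow> degP \<tau> = degP \<sigma>"
  by (auto simp: orbit_def degP_cst_mult)

text \<open>
  A description of the space of states without reference to its decomposition into degrees: the
  degree of a section is determined by the section, so the homogeneity condition can be stated
  for all sections at once.
\<close>

definition is_state :: "nat \<Rightarrow> complex set \<Rightarrow> state \<Rightarrow> bool" where
  "is_state N A \<rho> \<longleftrightarrow>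
     (\<forall>\<sigma>. \<rho> \<sigma> \<noteq> 0 \<longrightarrow> \<sigma> \<noteq> 0 \<and> (\<forall>z\<in>A. unit_at z \<sigma>)) \<and>
     (\<forall>\<sigma>. \<rho> \<sigma> \<in> Wsub A) \<and>
     (\<forall>\<sigma> t. \<sigma> \<noteq> 0 \<longrightarrow> t \<noteq> 0 \<longrightarrow> \<rho> (cst t * \<sigma>) = sconst (t powi (int N * degP \<sigma>)) * \<rho> \<sigma>) \<and>
     finite (orbit ` {\<sigma>. \<rho> \<sigma> \<noteq> 0})"

lemma is_stateD:
  assumes "is_state N A \<rho>"
  shows "\<rho> \<sigma> \<noteq> 0 \<Longrightarrow> \<sigma> \<noteq> 0" "\<rho> \<sigma> \<noteq> 0 \<Longrightarrow> z \<in> A \<Longrightarrow> unit_at z \<sigma>" "\<rho> \<sigma> \<in> Wsub A"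
    "\<sigma> \<noteq> 0 \<Longrightarrow> t \<noteq> 0 \<Longrightarrow> \<rho> (cst t * \<sigma>) = sconst (t powi (int N * degP \<sigma>)) * \<rho> \<sigma>"
    "finite (orbit ` {\<sigma>. \<rho> \<sigma> \<noteq> 0})"
proof -
  note d = assms[unfolded is_state_def]
  show "\<rho> \<sigma> \<noteq> 0 \<Longrightarrow> \<sigma> \<noteq> 0" "\<rho> \<sigma> \<noteq> 0 \<Longrightarrow> z \<in> A \<Longrightarrow> unit_at z \<sigma>"
    using d[THEN conjunct1] by blast+
  show "\<rho> \<sigma> \<in> Wsub A"
    using d[THEN conjunct2, THEN conjunct1] by blast
  show "\<sigma> \<noteq> 0 \<Longrightarrow> t \<noteq> 0 \<Longrightarrow> \<rho> (cst t * \<sigma>) = sconst (t powi (int N * degP \<sigma>)) * \<rho> \<sigma>"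
    using d[THEN conjunct2, THEN conjunct2, THEN conjunct1] by blast
  show "finite (orbit ` {\<sigma>. \<rho> \<sigma> \<noteq> 0})"
    using d[THEN conjunct2, THEN conjunct2, THEN conjunct2] .
qed

lemma unit_at_cst_mult_iff:
  assumes "t \<noteq> 0" shows "unit_at z (cst t * \<sigma>) \<longleftrightarrow> unit_at z \<sigma>"
proof
  assume "unit_at z (cst t * \<sigma>)"
  then have "unit_at z (cst (inverse t) * (cst t * \<sigma>))"
    using assms by (intro unit_at_mult[of z "cst (inverse t)"]) (simp_all add: unit_at_cst)
  moreover have "cst (inverse t) * (cst t * \<sigma>) = cst (inverse t * t) * \<sigma>"
    by (simp only: cst_mult mult.assoc)
  then have "cst (inverse t) * (cst t * \<sigma>) = \<sigma>" using assms by simp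
  ultimately show "unit_at z \<sigma>" by (simp only:)
next
  assume "unit_at z \<sigma>"
  then show "unit_at z (cst t * \<sigma>)"
    using assms by (intro unit_at_mult) (simp_all add: unit_at_cst)
qed

lemma Wt_deg_iff: "\<rho> \<in> Wt_deg N A l \<longleftrightarrow> is_state N A \<rho> \<and> (\<forall>\<sigma>. \<rho> \<sigma> \<noteq> 0 \<longrightarrow> degP \<sigma> = l)"
proof
  assume \<rho>: "\<rho> \<in> Wt_deg N A l"
  have supp: "\<sigma> \<in> Ksec A l" if "\<rho> \<sigma> \<noteq> 0" for \<sigma>
    using \<rho> that by (auto simp: Wt_deg_def)
  have W: "\<rho> \<sigma> \<in> Wsub A" for \<sigma>
    using \<rho> by (cases "\<sigma> \<in> Ksec A l") (auto simp: Wt_deg_def)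
  have hom: "\<rho> (cst t * \<sigma>) = sconst (t powi (int N * degP \<sigma>)) * \<rho> \<sigma>" if "\<sigma> \<noteq> 0" "t \<noteq> 0" for \<sigma> t
  proof (cases "\<sigma> \<in> Ksec A l")
    case True
    then show ?thesis using \<rho> that by (auto simp: Wt_deg_def Ksec_iff)
  next
    case False
    then have "cst t * \<sigma> \<notin> Ksec A l"
      using that by (auto simp: Ksec_iff degP_cst_mult unit_at_cst_mult_iff)
    then show ?thesis using supp False by (metis mult_zero_right)
  qed
  show "is_state N A \<rho> \<and> (\<forall>\<sigma>. \<rho> \<sigma> \<noteq> 0 \<longrightarrow> degP \<sigma> = l)"
  proof -
    have "finite (orbit ` {\<sigma>. \<rho> \<sigma> \<noteq> 0})" using \<rho> by (simp add: Wt_deg_def)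
    then show ?thesis unfolding is_state_def using supp[unfolded Ksec_iff] W hom by blast
  qed
next
  assume "is_state N A \<rho> \<and> (\<forall>\<sigma>. \<rho> \<sigma> \<noteq> 0 \<longrightarrow> degP \<sigma> = l)"
  then have \<rho>: "is_state N A \<rho>" and l: "\<And>\<sigma>. \<rho> \<sigma> \<noteq> 0 \<Longrightarrow> degP \<sigma> = l" by auto
  have "\<rho> \<sigma> = 0" if "\<sigma> \<notin> Ksec A l" for \<sigma>
    using that is_stateD(1,2)[OF \<rho>] l unfolding Ksec_iff by blast
  moreover have "\<rho> (cst t * \<sigma>) = sconst (t powi (int N * l)) * \<rho> \<sigma>"
    if "\<sigma> \<in> Ksec A l" "t \<noteq> 0" for \<sigma> t
    using is_stateD(4)[OF \<rho>, of \<sigma> t] that by (simp add: Ksec_iff)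
  ultimately show "\<rho> \<in> Wt_deg N A l"
    unfolding Wt_deg_def using is_stateD(3,5)[OF \<rho>] by simp
qed

lemma is_state_0: "is_state N A 0"
  by (simp add: is_state_def)

lemma is_state_add:
  assumes "is_state N A \<rho>" "is_state N A \<rho>'"
  shows "is_state N A (\<rho> + \<rho>')"
proof -
  have "orbit ` {\<sigma>. (\<rho> + \<rho>') \<sigma> \<noteq> 0} \<subseteq> orbit ` {\<sigma>. \<rho> \<sigma> \<noteq> 0} \<union> orbit ` {\<sigma>. \<rho>' \<sigma> \<noteq> 0}"
    by auto
  then have "finite (orbit ` {\<sigma>. (\<rho> + \<rho>') \<sigma> \<noteq> 0})"
    using is_stateD(5)[OF assms(1)] is_stateD(5)[OF assms(2)] by (meson finite_Un finite_subset)
  moreover have "\<sigma> \<noteq> 0 \<and> (\<forall>z\<in>A. unit_at z \<sigma>)" if "(\<rho> + \<rho>') \<sigma> \<noteq> 0" for \<sigma>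
  proof -
    have "\<rho> \<sigma> \<noteq> 0 \<or> \<rho>' \<sigma> \<noteq> 0" using that by auto
    then show ?thesis using is_stateD(1,2)[OF assms(1)] is_stateD(1,2)[OF assms(2)] by blast
  qed
  moreover have "(\<rho> + \<rho>') \<sigma> \<in> Wsub A" for \<sigma>
    using is_stateD(3)[OF assms(1)] is_stateD(3)[OF assms(2)] by (simp add: Wsub_add)
  moreover have "(\<rho> + \<rho>') (cst t * \<sigma>) = sconst (t powi (int N * degP \<sigma>)) * (\<rho> + \<rho>') \<sigma>"
    if "\<sigma> \<noteq> 0" "t \<noteq> 0" for \<sigma> t
    using is_stateD(4)[OF assms(1) that] is_stateD(4)[OF assms(2) that] by (simp add: distrib_left)
  ultimately show ?thesis unfolding is_state_def by blast
qed

lemma is_state_sum: "finite L \<Longrightarrow> (\<And>l. l \<in> L \<Longrightarrow> is_state N A (\<rho> l)) \<Longrightarrow> is_state N A (\<Sum>l\<in>L. \<rho> l)"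
  by (induction L rule: finite_induct) (auto simp: is_state_0 is_state_add)

lemma sum_state_apply: "(\<Sum>l\<in>L. \<rho> l) \<sigma> = (\<Sum>l\<in>L. (\<rho> l :: state) \<sigma>)"
  by (induction L rule: infinite_finite_induct) auto

lemma is_state_restrict:
  assumes "is_state N A \<rho>" and inv: "\<And>\<sigma> t. \<sigma> \<noteq> 0 \<Longrightarrow> t \<noteq> 0 \<Longrightarrow> Q (cst t * \<sigma>) \<longleftrightarrow> Q \<sigma>"
  shows "is_state N A (\<lambda>\<sigma>. if Q \<sigma> then \<rho> \<sigma> else 0)"
proof -
  have "orbit ` {\<sigma>. (if Q \<sigma> then \<rho> \<sigma> else 0) \<noteq> 0} \<subseteq> orbit ` {\<sigma>. \<rho> \<sigma> \<noteq> 0}" by auto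
  then have "finite (orbit ` {\<sigma>. (if Q \<sigma> then \<rho> \<sigma> else 0) \<noteq> 0})"
    using is_stateD(5)[OF assms(1)] by (rule finite_subset)
  then show ?thesis
    using is_stateD(1-4)[OF assms(1)] inv unfolding is_state_def by auto
qed

lemma Wt_iff: "\<rho> \<in> Wt N A \<longleftrightarrow> is_state N A \<rho>"
proof
  assume "\<rho> \<in> Wt N A"
  then show "is_state N A \<rho>" by (auto simp: Wt_def Wt_deg_iff intro!: is_state_sum)
next
  assume \<rho>: "is_state N A \<rho>"
  let ?S = "{\<sigma>. \<rho> \<sigma> \<noteq> 0}"
  let ?r = "\<lambda>l \<sigma>. if degP \<sigma> = l then \<rho> \<sigma> else 0"
  \<comment> \<open>The degree is constant on orbits, so only finitely many degrees occur.\<close>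
  have "degP \<sigma> = degP (SOME \<tau>. \<tau> \<in> orbit \<sigma>)" if "\<sigma> \<in> ?S" for \<sigma>
    using degP_orbit[of "SOME \<tau>. \<tau> \<in> orbit \<sigma>" \<sigma>] is_stateD(1)[OF \<rho>] that
      someI[of "\<lambda>\<tau>. \<tau> \<in> orbit \<sigma>", OF orbit_refl] by auto
  then have "degP ` ?S = (\<lambda>X. degP (SOME \<tau>. \<tau> \<in> X)) ` orbit ` ?S"
    unfolding image_image by (intro image_cong) auto
  then have fin: "finite (degP ` ?S)" using is_stateD(5)[OF \<rho>] by simp
  have "?r l \<in> Wt_deg N A l" for l
    unfolding Wt_deg_iff using is_state_restrict[OF \<rho>, of "\<lambda>\<sigma>. degP \<sigma> = l"]
    by (auto simp: degP_cst_mult)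
  moreover have "\<rho> = (\<Sum>l\<in>degP ` ?S. ?r l)"
  proof
    show "\<rho> \<sigma> = (\<Sum>l\<in>degP ` ?S. ?r l) \<sigma>" for \<sigma>
      using fin by (cases "\<rho> \<sigma> = 0") (auto simp: sum_state_apply)
  qed
  ultimately show "\<rho> \<in> Wt N A" unfolding Wt_def using fin by blast
qed

lemma Wt_deg_subset: "\<rho> \<in> Wt_deg N A l \<Longrightarrow> \<rho> \<in> Wt N A"
  by (simp add: Wt_deg_iff Wt_iff)

lemma is_state_mono:
  assumes "is_state N A \<rho>" "B \<subseteq> A" shows "is_state N B \<rho>"
proof -
  have "\<sigma> \<noteq> 0 \<and> (\<forall>z\<in>B. unit_at z \<sigma>)" if "\<rho> \<sigma> \<noteq> 0" for \<sigma>
    using is_stateD(1,2)[OF assms(1) that] assms(2) by blast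
  moreover have "\<rho> \<sigma> \<in> Wsub B" for \<sigma>
    using Wsub_mono[OF is_stateD(3)[OF assms(1)] assms(2)] .
  ultimately show ?thesis
    unfolding is_state_def using is_stateD(4,5)[OF assms(1)] by blast
qed

lemma is_state_mult:
  assumes "is_state N A \<rho>" "v \<in> Wsub A"
  shows "is_state N A (\<lambda>\<sigma>. v * \<rho> \<sigma>)"
proof -
  have "orbit ` {\<sigma>. v * \<rho> \<sigma> \<noteq> 0} \<subseteq> orbit ` {\<sigma>. \<rho> \<sigma> \<noteq> 0}" by auto
  then have "finite (orbit ` {\<sigma>. v * \<rho> \<sigma> \<noteq> 0})"
    using is_stateD(5)[OF assms(1)] by (rule finite_subset)
  moreover have "\<rho> \<sigma> \<noteq> 0" if "v * \<rho> \<sigma> \<noteq> 0" for \<sigma> using that by auto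
  ultimately show ?thesis
    using is_stateD(1-4)[OF assms(1)] assms(2) unfolding is_state_def
    by (auto simp: Wsub_mult mult.left_commute)
qed

lemma is_state_smul: "is_state N A \<rho> \<Longrightarrow> is_state N A (smul c \<rho>)"
  unfolding smul_def by (rule is_state_mult) (auto intro: Wsub_const)

lemma is_state_fmul:
  "is_state N A \<rho> \<Longrightarrow> (\<And>z. z \<in> A \<Longrightarrow> regular_at (fun_of b) z) \<Longrightarrow> is_state N A (fmul b \<rho>)"
  unfolding fmul_def by (rule is_state_mult) (auto intro: Wsub_gen)

lemma tensE_cst_mult:
  assumes "\<sigma> \<noteq> 0" "t \<noteq> 0"
  shows "tensE N l v \<sigma> (cst t * \<sigma>) = sconst (t powi (int N * l)) * v"
proof -
  have "(THE s. cst t * \<sigma> = cst s * \<sigma>) = t" using assms by auto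
  then show ?thesis using assms by (auto simp: tensE_def orbit_def)
qed

lemma tensE_outside: "\<tau> \<notin> orbit \<sigma> \<Longrightarrow> tensE N l v \<sigma> \<tau> = 0"
  by (simp add: tensE_def)

lemma tensE_mult: "tensE N l v \<sigma> = (\<lambda>\<tau>. v * tensE N l 1 \<sigma> \<tau>)"
  by (simp add: tensE_def fun_eq_iff mult.commute)

lemma tensE_in_Wt_deg:
  assumes "\<sigma> \<in> Ksec A l" "v \<in> Wsub A"
  shows "tensE N l v \<sigma> \<in> Wt_deg N A l"
proof -
  have \<sigma>: "\<sigma> \<noteq> 0" "degP \<sigma> = l" "\<And>z. z \<in> A \<Longrightarrow> unit_at z \<sigma>"
    using assms by (auto simp: Ksec_iff)
  have supp: "\<tau> \<in> orbit \<sigma>" if "tensE N l v \<sigma> \<tau> \<noteq> 0" for \<tau>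
    using that tensE_outside by metis
  have "orbit ` {\<tau>. tensE N l v \<sigma> \<tau> \<noteq> 0} \<subseteq> {orbit \<sigma>}"
    using supp orbit_eq_iff[of _ \<sigma>] by blast
  then have fin: "finite (orbit ` {\<tau>. tensE N l v \<sigma> \<tau> \<noteq> 0})" by (rule finite_subset) simp
  have W: "tensE N l v \<sigma> \<tau> \<in> Wsub A" for \<tau>
    using assms by (auto simp: tensE_def intro: Wsub.intros)
  have hom: "tensE N l v \<sigma> (cst t * \<tau>) = sconst (t powi (int N * degP \<tau>)) * tensE N l v \<sigma> \<tau>"
    if "\<tau> \<noteq> 0" "t \<noteq> 0" for t \<tau>
  proof (cases "\<tau> \<in> orbit \<sigma>")
    case True
    then obtain s where s: "s \<noteq> 0" "\<tau> = cst s * \<sigma>" by (auto simp: orbit_def)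
    have "cst t * \<tau> = cst (t * s) * \<sigma>" by (simp add: s cst_mult mult.assoc)
    then have "tensE N l v \<sigma> (cst t * \<tau>) = sconst ((t * s) powi (int N * l)) * v"
      using s that \<sigma> by (simp only: tensE_cst_mult mult_eq_0_iff simp_thms)
    then show ?thesis
      using s that \<sigma> tensE_cst_mult[of \<sigma> s N l v]
      by (simp add: degP_cst_mult power_int_mult_distrib sconst_mult mult.assoc)
  next
    case False
    then have "cst t * \<tau> \<notin> orbit \<sigma>" using that by (simp add: orbit_cst_mult_iff)
    with False show ?thesis by (simp add: tensE_outside)
  qed
  have "\<tau> \<noteq> 0 \<and> degP \<tau> = l \<and> (\<forall>z\<in>A. unit_at z \<tau>)" if "tensE N l v \<sigma> \<tau> \<noteq> 0" for \<tau>
  proof -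
    have "\<tau> \<in> orbit \<sigma>" using supp that by blast
    then obtain s where "s \<noteq> 0" "\<tau> = cst s * \<sigma>" by (auto simp: orbit_def)
    then show ?thesis using \<sigma> by (simp add: unit_at_cst_mult_iff degP_cst_mult)
  qed
  then show ?thesis
    unfolding Wt_deg_iff is_state_def using fin W hom by blast
qed

text \<open>
  The space of states is generated by the vectors \<open>1 \<otimes> E[\<sigma>]\<close> under linear combinations and
  multiplication by functions. The induction is on the number of orbits on which a state is nonzero;
  the part of \<open>\<rho>\<close> on the orbit of \<open>\<sigma>\<close> is \<open>\<rho>(\<sigma>) \<otimes> E[\<sigma>]\<close>.
\<close>

lemma Wt_induct [consumes 1, case_names zero add scale vacuum gen]:
  assumes "\<rho> \<in> Wt N A"
    and zero: "P 0"
    and add: "\<And>\<rho> \<rho>'. \<rho> \<in> Wt N A \<Longrightarrow> \<rho>' \<in> Wt N A \<Longrightarrow> P \<rho> \<Longrightarrow> P \<rho>' \<Longrightarrow> P (\<rho> + \<rho>')"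
    and scale: "\<And>c \<rho>. \<rho> \<in> Wt N A \<Longrightarrow> P \<rho> \<Longrightarrow> P (smul c \<rho>)"
    and vac: "\<And>l \<sigma>. \<sigma> \<in> Ksec A l \<Longrightarrow> P (tensE N l 1 \<sigma>)"
    and gen: "\<And>b \<rho>. (\<And>z. z \<in> A \<Longrightarrow> regular_at (fun_of b) z) \<Longrightarrow> \<rho> \<in> Wt N A \<Longrightarrow> P \<rho> \<Longrightarrow> P (fmul b \<rho>)"
  shows "P \<rho>"
proof -
  have mult: "P (\<lambda>\<tau>. v * \<rho> \<tau>)" if "v \<in> Wsub A" "\<rho> \<in> Wt N A" "P \<rho>" for v \<rho>
    using that
  proof (induction v arbitrary: \<rho> rule: Wsub.induct)
    case (Wsub_const c)
    then show ?case using scale by (simp add: smul_def)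
  next
    case (Wsub_gen b)
    then show ?case using gen by (simp add: fmul_def)
  next
    case (Wsub_add v w)
    have "(\<lambda>\<tau>. (v + w) * \<rho> \<tau>) = (\<lambda>\<tau>. v * \<rho> \<tau>) + (\<lambda>\<tau>. w * \<rho> \<tau>)"
      by (simp add: fun_eq_iff distrib_right)
    then show ?case
      using add[of "\<lambda>\<tau>. v * \<rho> \<tau>" "\<lambda>\<tau>. w * \<rho> \<tau>"] Wsub_add by (simp add: Wt_iff is_state_mult)
  next
    case (Wsub_mult v w)
    have "P (\<lambda>\<tau>. v * (w * \<rho> \<tau>))"
      by (rule Wsub_mult.IH(1)) (use Wsub_mult in \<open>simp_all add: Wt_iff is_state_mult\<close>)
    then show ?case by (simp add: mult.assoc)
  qed
  have tens: "P (tensE N l v \<sigma>)" if "\<sigma> \<in> Ksec A l" "v \<in> Wsub A" for l v \<sigma>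
    unfolding tensE_mult[of N l v]
    by (intro mult that vac Wt_deg_subset[OF tensE_in_Wt_deg] Wsub_1)
  have "is_state N A \<rho>" using assms(1) by (simp add: Wt_iff)
  then show ?thesis
  proof (induction "card (orbit ` {\<sigma>. \<rho> \<sigma> \<noteq> 0})" arbitrary: \<rho> rule: less_induct)
    case less
    show ?case
    proof (cases "\<rho> = 0")
      case True
      then show ?thesis using zero by simp
    next
      case False
      then obtain \<sigma> where \<sigma>: "\<rho> \<sigma> \<noteq> 0" by (auto simp: fun_eq_iff)
      let ?\<rho>' = "\<lambda>\<tau>. if \<tau> \<notin> orbit \<sigma> then \<rho> \<tau> else 0"
      let ?t = "tensE N (degP \<sigma>) (\<rho> \<sigma>) \<sigma>"
      have K: "\<sigma> \<in> Ksec A (degP \<sigma>)" using is_stateD(1,2)[OF less.prems \<sigma>] by (auto simp: Ksec_iff)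
      have good': "is_state N A ?\<rho>'"
        by (rule is_state_restrict[OF less.prems]) (simp add: orbit_cst_mult_iff)
      have "orbit ` {\<tau>. ?\<rho>' \<tau> \<noteq> 0} \<subset> orbit ` {\<tau>. \<rho> \<tau> \<noteq> 0}"
      proof
        show "orbit ` {\<tau>. ?\<rho>' \<tau> \<noteq> 0} \<subseteq> orbit ` {\<tau>. \<rho> \<tau> \<noteq> 0}" by auto
        have "orbit \<sigma> \<notin> orbit ` {\<tau>. ?\<rho>' \<tau> \<noteq> 0}"
          using orbit_eq_iff[of _ \<sigma>] by (auto split: if_splits)
        then show "orbit ` {\<tau>. ?\<rho>' \<tau> \<noteq> 0} \<noteq> orbit ` {\<tau>. \<rho> \<tau> \<noteq> 0}" using \<sigma> by blast
      qed
      then have "card (orbit ` {\<tau>. ?\<rho>' \<tau> \<noteq> 0}) < card (orbit ` {\<tau>. \<rho> \<tau> \<noteq> 0})"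
        using is_stateD(5)[OF less.prems] by (rule psubset_card_mono[rotated])
      from less.hyps[OF this good'] have "P ?\<rho>'" .
      moreover have "P ?t" using tens K is_stateD(3)[OF less.prems] by blast
      moreover have "\<rho> = ?t + ?\<rho>'"
      proof
        fix \<tau>
        show "\<rho> \<tau> = (?t + ?\<rho>') \<tau>"
        proof (cases "\<tau> \<in> orbit \<sigma>")
          case True
          then obtain s where s: "s \<noteq> 0" "\<tau> = cst s * \<sigma>" by (auto simp: orbit_def)
          then show ?thesis
            using True is_stateD(1,4)[OF less.prems] \<sigma> by (simp add: tensE_cst_mult)
        qed (simp add: tensE_outside)
      qed
      moreover have "?t \<in> Wt N A"
        using tensE_in_Wt_deg[OF K is_stateD(3)[OF less.prems]] by (rule Wt_deg_subset)
      ultimately show ?thesis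
        using add[of ?t ?\<rho>'] good' by (simp add: Wt_iff)
    qed
  qed
qed

lemma Wt_mono: "\<rho> \<in> Wt N A \<Longrightarrow> B \<subseteq> A \<Longrightarrow> \<rho> \<in> Wt N B"
  unfolding Wt_iff by (rule is_state_mono)

lemma Wt_add: "\<rho> \<in> Wt N A \<Longrightarrow> \<rho>' \<in> Wt N A \<Longrightarrow> \<rho> + \<rho>' \<in> Wt N A"
  by (simp add: Wt_iff is_state_add)

lemma Wt_smul: "\<rho> \<in> Wt N A \<Longrightarrow> smul c \<rho> \<in> Wt N A"
  by (simp add: Wt_iff is_state_smul)

lemma Wt_fmul:
  "\<rho> \<in> Wt N A \<Longrightarrow> (\<And>z. z \<in> A \<Longrightarrow> regular_at (fun_of b) z) \<Longrightarrow> fmul b \<rho> \<in> Wt N A"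
  by (simp add: Wt_iff is_state_fmul)

lemma Wt_tensE: "\<sigma> \<in> Ksec A l \<Longrightarrow> tensE N l 1 \<sigma> \<in> Wt N A"
  by (erule Wt_deg_subset[OF tensE_in_Wt_deg]) simp

lemma linear_on_statesD:
  assumes "linear_on_states S F" "\<rho> \<in> S"
  shows "\<rho>' \<in> S \<Longrightarrow> F (\<rho> + \<rho>') = F \<rho> + F \<rho>'" "F (smul c \<rho>) = smul c (F \<rho>)"
  using assms by (simp_all add: linear_on_states_def)

text \<open>A linear operator is determined by its commutators with functions and its values on \<open>1 \<otimes> E[\<sigma>]\<close>.\<close>

lemma operator_unique:
  assumes F: "linear_on_states (Wt N A) F" and G: "linear_on_states (Wt N A) G"
    and vac: "\<And>l \<sigma>. \<sigma> \<in> Ksec A l \<Longrightarrow> F (tensE N l 1 \<sigma>) = G (tensE N l 1 \<sigma>)"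
    and gen: "\<And>b \<rho>. (\<And>z. z \<in> A \<Longrightarrow> regular_at (fun_of b) z) \<Longrightarrow> \<rho> \<in> Wt N A \<Longrightarrow>
      F \<rho> = G \<rho> \<Longrightarrow> F (fmul b \<rho>) = G (fmul b \<rho>)"
    and "\<rho> \<in> Wt N A"
  shows "F \<rho> = G \<rho>"
  using assms(5)
proof (induction rule: Wt_induct)
  case zero
  have z: "smul 0 \<rho> = 0" for \<rho> by (simp add: smul_def fun_eq_iff)
  have "0 \<in> Wt N A" by (simp add: Wt_iff is_state_0)
  then have "F (smul 0 0) = smul 0 (F 0)" "G (smul 0 0) = smul 0 (G 0)"
    using F G by (simp_all add: linear_on_states_def)
  then have "F 0 = 0" "G 0 = 0" by (simp_all only: z)
  then show ?case by (simp only:)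
next
  case (add \<rho> \<rho>')
  then show ?case by (simp only: linear_on_statesD(1)[OF F] linear_on_statesD(1)[OF G])
next
  case (scale c \<rho>)
  then show ?case by (simp only: linear_on_statesD(2)[OF F] linear_on_statesD(2)[OF G])
next
  case (vacuum l \<sigma>)
  then show ?case by (rule vac)
next
  case (gen b \<rho>)
  then show ?case by (rule assms(4))
qed

text \<open>
  Both \<open>\<iota>(z)\<close> and the vertex fields have the form \<open>\<rho> \<mapsto> (\<tau> \<mapsto> T \<sigma> (\<rho> \<sigma>))\<close> with \<open>\<sigma> = g \<tau>\<close>. The
  homogeneity of \<open>T\<close> compensates for the difference between the degrees of \<open>\<sigma>\<close> and of \<open>\<tau>\<close>.
\<close>

lemma is_state_transport:
  assumes \<rho>: "is_state N A \<rho>" and g: "g \<noteq> 0" "\<And>z. z \<in> B \<Longrightarrow> unit_at z g" and "B \<subseteq> A"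
    and T0: "\<And>\<sigma>. T \<sigma> 0 = 0"
    and TW: "\<And>\<sigma> v. v \<in> Wsub A \<Longrightarrow> T \<sigma> v \<in> Wsub B"
    and Thom: "\<And>\<sigma> v t x. \<sigma> \<noteq> 0 \<Longrightarrow> (\<And>z. z \<in> A \<Longrightarrow> unit_at z \<sigma>) \<Longrightarrow> t \<noteq> 0 \<Longrightarrow>
      T (cst t * \<sigma>) (sconst x * v) = sconst (x * t powi (- int N * degP g)) * T \<sigma> v"
  shows "is_state N B (\<lambda>\<tau>. T (g * \<tau>) (\<rho> (g * \<tau>)))"
proof -
  have supp: "\<rho> (g * \<tau>) \<noteq> 0" if "T (g * \<tau>) (\<rho> (g * \<tau>)) \<noteq> 0" for \<tau>
    using that T0 by metis
  have nz: "\<tau> \<noteq> 0" if "T (g * \<tau>) (\<rho> (g * \<tau>)) \<noteq> 0" for \<tau>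
    using is_stateD(1)[OF \<rho> supp[OF that]] by simp
  have unit: "unit_at z \<tau>" if "T (g * \<tau>) (\<rho> (g * \<tau>)) \<noteq> 0" "z \<in> B" for \<tau> z
  proof -
    have "unit_at z (inverse g)" "unit_at z (g * \<tau>)"
      using is_stateD(2)[OF \<rho> supp[OF that(1)]] that(2) assms(4) g(2) by (auto intro: unit_at_inverse)
    then have "unit_at z (inverse g * (g * \<tau>))" by (rule unit_at_mult)
    moreover have "inverse g * (g * \<tau>) = \<tau>"
      using g(1) by (simp add: mult.assoc[symmetric])
    ultimately show ?thesis by simp
  qed
  have hom: "T (g * (cst t * \<tau>)) (\<rho> (g * (cst t * \<tau>))) =
      sconst (t powi (int N * degP \<tau>)) * T (g * \<tau>) (\<rho> (g * \<tau>))" if "\<tau> \<noteq> 0" "t \<noteq> 0" for t \<tau>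
  proof -
    have e: "g * (cst t * \<tau>) = cst t * (g * \<tau>)" by (simp add: mult.left_commute)
    have h: "\<rho> (cst t * (g * \<tau>)) = sconst (t powi (int N * degP (g * \<tau>))) * \<rho> (g * \<tau>)"
      using is_stateD(4)[OF \<rho>] g that by simp
    show ?thesis
    proof (cases "\<rho> (g * \<tau>) = 0")
      case True
      then show ?thesis by (simp add: e h T0)
    next
      case False
      have "T (cst t * (g * \<tau>)) (sconst (t powi (int N * degP (g * \<tau>))) * \<rho> (g * \<tau>)) =
          sconst (t powi (int N * degP (g * \<tau>)) * t powi (- int N * degP g)) * T (g * \<tau>) (\<rho> (g * \<tau>))"
        using is_stateD(1,2)[OF \<rho> False] that by (intro Thom) auto
      also have "t powi (int N * degP (g * \<tau>)) * t powi (- int N * degP g) = t powi (int N * degP \<tau>)"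
        using that g by (simp add: power_int_add[symmetric] degP_mult algebra_simps)
      finally show ?thesis by (simp add: e h)
    qed
  qed
  let ?S = "{\<tau>. T (g * \<tau>) (\<rho> (g * \<tau>)) \<noteq> 0}"
  have "inj_on (\<lambda>X. (*) g ` X) (orbit ` ?S)"
    using g by (intro inj_on_image inj_onI) auto
  moreover have "(\<lambda>X. (*) g ` X) ` orbit ` ?S \<subseteq> orbit ` {\<sigma>. \<rho> \<sigma> \<noteq> 0}"
  proof -
    have "(*) g ` orbit \<tau> = orbit (g * \<tau>)" for \<tau>
      by (auto simp: orbit_def mult.left_commute image_iff)
    then show ?thesis using supp by auto
  qed
  ultimately have "finite (orbit ` ?S)"
    using is_stateD(5)[OF \<rho>] by (meson finite_imageD finite_subset)
  then show ?thesis
    unfolding is_state_def using nz unit TW[OF is_stateD(3)[OF \<rho>]] hom by auto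
qed

section \<open>An explicit formula for \<open>\<iota>(z)\<close>\<close>

text \<open>The formula for \<open>\<iota>(z)\<close>, written down for arbitrary functions on sections.\<close>

definition iota_op :: "nat \<Rightarrow> complex \<Rightarrow> state \<Rightarrow> state" where
  "iota_op N z \<rho> = (\<lambda>\<tau>. sderiv z (\<rho> \<tau>) - sconst (complex_of_real (sqrt N) * dlog \<tau> z) * \<rho> \<tau>)"

lemma iota_op_Wt:
  assumes "\<rho> \<in> Wt N A" "z \<in> A"
  shows "iota_op N z \<rho> \<in> Wt N A"
proof -
  let ?T = "\<lambda>\<sigma> v. sderiv z v - sconst (complex_of_real (sqrt N) * dlog \<sigma> z) * v"
  have W: "?T \<sigma> v \<in> Wsub A" if "v \<in> Wsub A" for \<sigma> v
    using that by (intro Wsub_diff Wsub_mult sderiv_Wsub Wsub_const)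
  have hom: "?T (cst t * \<sigma>) (sconst x * v) = sconst (x * t powi (- int N * degP 1)) * ?T \<sigma> v"
    if "\<And>z. z \<in> A \<Longrightarrow> unit_at z \<sigma>" "t \<noteq> 0" for \<sigma> v t x
  proof -
    have "dlog (cst t * \<sigma>) z = dlog \<sigma> z"
      using that assms(2) by (intro dlog_cst_mult) auto
    then show ?thesis by (simp only:) (simp add: sderiv_mult algebra_simps)
  qed
  have "is_state N A (\<lambda>\<tau>. ?T (1 * \<tau>) (\<rho> (1 * \<tau>)))"
    by (rule is_state_transport[where A = A and T = ?T and g = 1])
      (use assms W hom in \<open>simp_all add: Wt_iff\<close>)
  then show ?thesis by (simp add: Wt_iff iota_op_def)
qed

lemma dlog_orbit: "\<tau> \<in> orbit \<sigma> \<Longrightarrow> unit_at z \<sigma> \<Longrightarrow> dlog \<tau> z = dlog \<sigma> z"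
  by (auto simp: orbit_def dlog_cst_mult)

lemma iota_op_is_iota_field: "is_iota_field N z (restrict (iota_op N z) (Wt N {z}))"
proof -
  let ?W = "Wt N {z}" and ?I = "iota_op N z"
  have "linear_on_states ?W (restrict ?I ?W)"
    unfolding linear_on_states_def
    by (simp add: Wt_add Wt_smul)
      (simp add: fun_eq_iff iota_op_def smul_def sderiv_add sderiv_mult algebra_simps)
  moreover have "restrict ?I ?W \<in> ?W \<rightarrow>\<^sub>E Wt N {}"
    using iota_op_Wt[of _ N "{z}" z] Wt_mono[of _ N "{z}" "{}"] by auto
  moreover have "restrict ?I ?W (fmul b \<rho>) - fmul b (restrict ?I ?W \<rho>) = smul (- d_at (fun_of b) z) \<rho>"
    if "regular_at (fun_of b) z" "\<rho> \<in> ?W" for b \<rho>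
    using that Wt_fmul[OF that(2), of b]
    by (simp add: fun_eq_iff iota_op_def fmul_def smul_def sderiv_mult sderiv_gen coeff_mP_regular algebra_simps
        del: One_nat_def)
  moreover have "restrict ?I ?W (tensE N l 1 \<sigma>) = smul (- complex_of_real (sqrt N) * dlog \<sigma> z) (tensE N l 1 \<sigma>)"
    if "\<sigma> \<in> Ksec {z} l" for l \<sigma>
    unfolding restrict_apply'[OF Wt_tensE[OF that]]
  proof
    fix \<tau>
    show "?I (tensE N l 1 \<sigma>) \<tau> = smul (- complex_of_real (sqrt N) * dlog \<sigma> z) (tensE N l 1 \<sigma>) \<tau>"
    proof (cases "\<tau> \<in> orbit \<sigma>")
      case True
      then show ?thesis
        using that dlog_orbit[OF True, of z] tensE_mult[of N l "1"]
        by (simp add: iota_op_def smul_def Ksec_iff tensE_def sconst_uminus)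
    next
      case False
      then show ?thesis by (simp add: iota_op_def smul_def tensE_outside)
    qed
  qed
  ultimately show ?thesis
    unfolding is_iota_field_def by blast
qed

lemma iota_field_eq:
  assumes "\<rho> \<in> Wt N {z}"
  shows "iota_field N z \<rho> = iota_op N z \<rho>"
proof -
  have "iota_field N z = restrict (iota_op N z) (Wt N {z})"
    unfolding iota_field_def
  proof (rule the_equality)
    show "is_iota_field N z (restrict (iota_op N z) (Wt N {z}))" by (rule iota_op_is_iota_field)
  next
    fix I assume I: "is_iota_field N z I"
    let ?J = "restrict (iota_op N z) (Wt N {z})"
    note J = iota_op_is_iota_field[of N z]
    have comm: "H (fmul b \<rho>) = smul (- d_at (fun_of b) z) \<rho> + fmul b (H \<rho>)"
      if "is_iota_field N z H" "regular_at (fun_of b) z" "\<rho> \<in> Wt N {z}" for H b \<rho>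
    proof -
      have "H (fmul b \<rho>) - fmul b (H \<rho>) = smul (- d_at (fun_of b) z) \<rho>"
        using that unfolding is_iota_field_def by blast
      then show ?thesis by (simp only: diff_eq_eq)
    qed
    have eq: "I \<rho> = ?J \<rho>" if "\<rho> \<in> Wt N {z}" for \<rho>
    proof (rule operator_unique[OF _ _ _ _ that])
      show "linear_on_states (Wt N {z}) I" "linear_on_states (Wt N {z}) ?J"
        using I J unfolding is_iota_field_def by blast+
      show "I (tensE N l 1 \<sigma>) = ?J (tensE N l 1 \<sigma>)" if "\<sigma> \<in> Ksec {z} l" for l \<sigma>
      proof -
        have "H (tensE N l 1 \<sigma>) = smul (- complex_of_real (sqrt N) * dlog \<sigma> z) (tensE N l 1 \<sigma>)"
          if "is_iota_field N z H" for H
          using that \<open>\<sigma> \<in> Ksec {z} l\<close> unfolding is_iota_field_def by blast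
        then show ?thesis using I J by metis
      qed
      show "I (fmul b \<rho>) = ?J (fmul b \<rho>)"
        if "\<And>w. w \<in> {z} \<Longrightarrow> regular_at (fun_of b) w" "\<rho> \<in> Wt N {z}" "I \<rho> = ?J \<rho>" for b \<rho>
        using comm[OF I _ that(2), of b] comm[OF J _ that(2), of b] that(1)[of z] that(3) by simp
    qed
    show "I = ?J"
    proof (rule extensionalityI)
      show "I \<in> extensional (Wt N {z})"
        using I unfolding is_iota_field_def PiE_def by blast
    qed (use eq in auto)
  qed
  then show ?thesis using assms by simp
qed

section \<open>An explicit formula for the vertex fields\<close>

text \<open>
  The scalar \<open>\<sigma>(z)\<^bsup>Nk\<^esup> du\<^sub>z\<^bsup>-Nk(l+k)\<^esup>\<close> by which the vertex field acts on \<open>1 \<otimes> E[\<sigma>]\<close>, with \<open>l\<close> the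
  degree of \<open>\<sigma>\<close>.
\<close>

definition vertex_factor :: "nat \<Rightarrow> int \<Rightarrow> mero \<Rightarrow> complex \<Rightarrow> ksec \<Rightarrow> complex" where
  "vertex_factor N k u z \<sigma> = val \<sigma> z powi (int N * k) * d_at u z powi (- int N * k * (degP \<sigma> + k))"

text \<open>
  The formula for \<open>V\<^sub>\<lambda>(z)\<close> with \<open>\<lambda> = \<surd>N k\<close>. Since \<open>E[\<sigma>]\<close> is sent to a multiple of
  \<open>E[(u - u(z))\<^bsup>-k\<^esup> \<sigma>]\<close>, the value of the new state at \<open>\<tau>\<close> comes from \<open>\<sigma> = (u - u(z))\<^sup>k \<tau>\<close>.
\<close>

definition vertex_op :: "nat \<Rightarrow> int \<Rightarrow> mero \<Rightarrow> complex \<Rightarrow> state \<Rightarrow> state" where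
  "vertex_op N k u z \<rho> = (\<lambda>\<tau>. let \<sigma> = (u - cst (val u z)) powi k * \<tau> in
     sconst (vertex_factor N k u z \<sigma>) * translate (- (complex_of_real (sqrt N) * of_int k)) z (\<rho> \<sigma>))"

lemma vertex_factor_cst_mult:
  assumes "t \<noteq> 0" "\<sigma> \<noteq> 0" "unit_at z \<sigma>"
  shows "vertex_factor N k u z (cst t * \<sigma>) = t powi (int N * k) * vertex_factor N k u z \<sigma>"
proof -
  have "val (cst t * \<sigma>) z = t * val \<sigma> z"
    using val_mult_unit[of z "cst t" \<sigma>] assms by (simp add: unit_at_cst)
  then show ?thesis
    by (simp add: vertex_factor_def degP_cst_mult assms power_int_mult_distrib)
qed

lemma vertex_op_is_state:
  assumes "coordinate u" "is_state N A \<rho>" "z \<in> A"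
  shows "is_state N (A - {z}) (vertex_op N k u z \<rho>)"
proof -
  let ?\<mu> = "- (complex_of_real (sqrt N) * of_int k)"
  let ?T = "\<lambda>\<sigma> v. sconst (vertex_factor N k u z \<sigma>) * translate ?\<mu> z v"
  let ?g = "(u - cst (val u z)) powi k"
  have W: "?T \<sigma> v \<in> Wsub (A - {z})" if "v \<in> Wsub A" for \<sigma> v
    using that by (intro Wsub_mult Wsub_const translate_Wsub) (erule Wsub_mono, blast)
  have hom: "?T (cst t * \<sigma>) (sconst x * v) = sconst (x * t powi (- int N * degP ?g)) * ?T \<sigma> v"
    if "\<sigma> \<noteq> 0" "\<And>z. z \<in> A \<Longrightarrow> unit_at z \<sigma>" "t \<noteq> 0" for \<sigma> v t x
    unfolding vertex_factor_cst_mult[OF that(3,1) that(2)[OF assms(3)]] coordinate_power(2)[OF assms(1)]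
    by (simp add: translate_mult sconst_mult mult_ac)
  have "is_state N (A - {z}) (\<lambda>\<tau>. ?T (?g * \<tau>) (\<rho> (?g * \<tau>)))"
  proof (rule is_state_transport[where A = A and T = ?T and g = ?g, OF assms(2)])
    show "?g \<noteq> 0" by (rule coordinate_power(1)[OF assms(1)])
    show "unit_at w ?g" if "w \<in> A - {z}" for w
      using that by (intro coordinate_power(3)[OF assms(1)]) auto
    show "?T \<sigma> 0 = 0" for \<sigma> by simp
  qed (blast, rule W, assumption, rule hom, assumption+)
  then show ?thesis by (simp add: vertex_op_def Let_def)
qed

lemma vertex_op_Wt:
  "coordinate u \<Longrightarrow> \<rho> \<in> Wt N A \<Longrightarrow> z \<in> A \<Longrightarrow> vertex_op N k u z \<rho> \<in> Wt N (A - {z})"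
  by (simp only: Wt_iff vertex_op_is_state)

lemma vertex_op_Wt_deg:
  assumes "coordinate u" "\<rho> \<in> Wt_deg N {z} l"
  shows "vertex_op N k u z \<rho> \<in> Wt_deg N {} (l + k)"
proof -
  let ?g = "(u - cst (val u z)) powi k"
  have \<rho>: "is_state N {z} \<rho>" and l: "\<And>\<sigma>. \<rho> \<sigma> \<noteq> 0 \<Longrightarrow> degP \<sigma> = l"
    using assms(2) by (auto simp: Wt_deg_iff)
  have "degP \<tau> = l + k" if "vertex_op N k u z \<rho> \<tau> \<noteq> 0" for \<tau>
  proof -
    have nz: "\<rho> (?g * \<tau>) \<noteq> 0"
      using that by (auto simp: vertex_op_def Let_def)
    have "?g * \<tau> \<noteq> 0" by (rule is_stateD(1)[OF \<rho> nz])
    then have "degP (?g * \<tau>) = - k + degP \<tau>"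
      by (simp add: degP_mult coordinate_power(2)[OF assms(1)])
    then show ?thesis using l[OF nz] by simp
  qed
  moreover have "is_state N {} (vertex_op N k u z \<rho>)"
    using vertex_op_is_state[OF assms(1) \<rho>, of z k] by simp
  ultimately show ?thesis by (simp add: Wt_deg_iff)
qed

lemma vertex_op_is_vertex_field:
  assumes u: "coordinate u"
  shows "is_vertex_field N k u z (restrict (vertex_op N k u z) (Wt N {z}))"
proof -
  let ?W = "Wt N {z}" and ?V = "vertex_op N k u z"
  let ?\<mu> = "complex_of_real (sqrt N) * of_int k"
  let ?g = "u - cst (val u z)"
  have "linear_on_states ?W (restrict ?V ?W)"
    unfolding linear_on_states_def
    by (simp add: Wt_add Wt_smul)
      (simp add: fun_eq_iff vertex_op_def Let_def smul_def translate_add translate_mult algebra_simps)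
  moreover have "restrict ?V ?W \<in> ?W \<rightarrow>\<^sub>E Wt N {}"
    using vertex_op_Wt[OF u, of _ N "{z}" z k] by auto
  moreover have "restrict ?V ?W \<rho> \<in> Wt_deg N {} (l + k)" if "\<rho> \<in> Wt_deg N {z} l" for l \<rho>
    using vertex_op_Wt_deg[OF u that] Wt_deg_subset[OF that] by simp
  moreover have "restrict ?V ?W (fmul b \<rho>) - fmul b (restrict ?V ?W \<rho>) =
      smul (- ?\<mu> * val (fun_of b) z) (restrict ?V ?W \<rho>)"
    if "regular_at (fun_of b) z" "\<rho> \<in> ?W" for b \<rho>
    using that Wt_fmul[OF that(2), of b]
    by (simp add: fun_eq_iff vertex_op_def Let_def fmul_def smul_def translate_mult translate_gen
        coeff_mP_regular algebra_simps)
  moreover have "restrict ?V ?W (tensE N l 1 \<sigma>) =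
      smul (val \<sigma> z powi (int N * k) * d_at u z powi (- int N * k * (l + k)))
        (tensE N (l + k) 1 (?g powi (- k) * \<sigma>))"
    if "\<sigma> \<in> Ksec {z} l" for l \<sigma>
    unfolding restrict_apply'[OF Wt_tensE[OF that]]
  proof
    fix \<tau>
    have \<sigma>: "\<sigma> \<noteq> 0" "degP \<sigma> = l" "unit_at z \<sigma>" using that by (auto simp: Ksec_iff)
    have g0: "?g powi k \<noteq> 0" by (rule coordinate_power(1)[OF u])
    have inv: "?g powi k * (?g powi (- k) * \<upsilon>) = \<upsilon>" for \<upsilon>
      using g0 by (simp add: power_int_minus mult.assoc[symmetric])
    have orb: "?g powi k * \<tau> \<in> orbit \<sigma> \<longleftrightarrow> \<tau> \<in> orbit (?g powi (- k) * \<sigma>)"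
      using orbit_mult_iff[OF g0, of \<tau> "?g powi (- k) * \<sigma>"] by (simp only: inv)
    show "?V (tensE N l 1 \<sigma>) \<tau> =
      smul (val \<sigma> z powi (int N * k) * d_at u z powi (- int N * k * (l + k)))
        (tensE N (l + k) 1 (?g powi (- k) * \<sigma>)) \<tau>"
    proof (cases "\<tau> \<in> orbit (?g powi (- k) * \<sigma>)")
      case True
      then obtain t where t: "t \<noteq> 0" "\<tau> = cst t * (?g powi (- k) * \<sigma>)" by (auto simp: orbit_def)
      have "?g powi k * \<tau> = cst t * (?g powi k * (?g powi (- k) * \<sigma>))"
        by (simp only: t mult.left_commute)
      then have g\<tau>: "?g powi k * \<tau> = cst t * \<sigma>" by (simp only: inv)
      have "?g powi (- k) * \<sigma> \<noteq> 0" by (rule no_zero_divisors[OF coordinate_power(1)[OF u] \<sigma>(1)])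
      then have R: "tensE N (l + k) 1 (?g powi (- k) * \<sigma>) \<tau> = sconst (t powi (int N * (l + k)))"
        unfolding t(2) using t(1) by (simp only: tensE_cst_mult mult_1_right simp_thms)
      have "?V (tensE N l 1 \<sigma>) \<tau> =
          sconst (t powi (int N * k) * vertex_factor N k u z \<sigma> * t powi (int N * l))"
        unfolding vertex_op_def Let_def g\<tau> vertex_factor_cst_mult[OF t(1) \<sigma>(1,3)]
          tensE_cst_mult[OF \<sigma>(1) t(1)]
        by (simp add: sconst_mult)
      also have "t powi (int N * k) * vertex_factor N k u z \<sigma> * t powi (int N * l) =
          vertex_factor N k u z \<sigma> * t powi (int N * (l + k))"
        using t(1) by (simp add: power_int_add distrib_left)
      finally show ?thesis
        unfolding smul_def R by (simp add: vertex_factor_def \<sigma>(2) sconst_mult)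
    next
      case False
      then show ?thesis
        using orb by (simp add: vertex_op_def Let_def smul_def tensE_outside)
    qed
  qed
  ultimately show ?thesis
    unfolding is_vertex_field_def by blast
qed

lemma vertex_field_eq:
  assumes u: "coordinate u" and \<rho>: "\<rho> \<in> Wt N {z}"
  shows "vertex_field N k u z \<rho> = vertex_op N k u z \<rho>"
proof -
  let ?J = "restrict (vertex_op N k u z) (Wt N {z})"
  note J = vertex_op_is_vertex_field[OF u, of N k z]
  have "vertex_field N k u z = ?J"
    unfolding vertex_field_def
  proof (rule the_equality)
    show "is_vertex_field N k u z ?J" by (rule J)
  next
    fix V assume V: "is_vertex_field N k u z V"
    have comm: "H (fmul b \<rho>) =
        smul (- (complex_of_real (sqrt N) * of_int k) * val (fun_of b) z) (H \<rho>) + fmul b (H \<rho>)"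
      if "is_vertex_field N k u z H" "regular_at (fun_of b) z" "\<rho> \<in> Wt N {z}" for H b \<rho>
    proof -
      have "H (fmul b \<rho>) - fmul b (H \<rho>) =
          smul (- (complex_of_real (sqrt N) * of_int k) * val (fun_of b) z) (H \<rho>)"
        using that unfolding is_vertex_field_def by blast
      then show ?thesis by (simp only: diff_eq_eq)
    qed
    have eq: "V \<rho> = ?J \<rho>" if "\<rho> \<in> Wt N {z}" for \<rho>
    proof (rule operator_unique[OF _ _ _ _ that])
      show "linear_on_states (Wt N {z}) V" "linear_on_states (Wt N {z}) ?J"
        using V J unfolding is_vertex_field_def by blast+
      show "V (tensE N l 1 \<sigma>) = ?J (tensE N l 1 \<sigma>)" if "\<sigma> \<in> Ksec {z} l" for l \<sigma>
      proof -
        have "H (tensE N l 1 \<sigma>) =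
          smul (val \<sigma> z powi (int N * k) * d_at u z powi (- int N * k * (l + k)))
            (tensE N (l + k) 1 ((u - cst (val u z)) powi (- k) * \<sigma>))"
          if "is_vertex_field N k u z H" for H
          using that \<open>\<sigma> \<in> Ksec {z} l\<close> unfolding is_vertex_field_def by blast
        then show ?thesis using V J by metis
      qed
      show "V (fmul b \<rho>) = ?J (fmul b \<rho>)"
        if "\<And>w. w \<in> {z} \<Longrightarrow> regular_at (fun_of b) w" "\<rho> \<in> Wt N {z}" "V \<rho> = ?J \<rho>" for b \<rho>
        using comm[OF V _ that(2), of b] comm[OF J _ that(2), of b] that(1)[of z] that(3) by simp
    qed
    show "V = ?J"
    proof (rule extensionalityI)
      show "V \<in> extensional (Wt N {z})"
        using V unfolding is_vertex_field_def PiE_def by blast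
    qed (use eq in auto)
  qed
  then show ?thesis using \<rho> by simp
qed

section \<open>The commutation relations\<close>

lemma eps_field_Wt:
  assumes "coordinate u" "\<rho> \<in> Wt N A" "z \<notin> A"
  shows "eps_field u z \<rho> \<in> Wt N A"
  unfolding eps_field_def
proof (intro Wt_smul Wt_fmul assms(2))
  fix w assume "w \<in> A"
  then have "unit_at w (inverse (u - cst (val u z)))"
    using assms(3) by (intro unit_at_inverse unit_at_coordinate_minus[OF assms(1)]) auto
  then show "regular_at (fun_of (Abs_mP (1 / (u - cst (val u z))))) w"
    unfolding fun_of_eps[OF assms(1)] unit_at_def by blast
qed

lemma j_commutes_with_vertex:
  assumes u: "coordinate u" and "z \<noteq> z'" and \<rho>: "\<rho> \<in> Wt N {z, z'}"
  shows "j_field N u z' (vertex_field N k u z \<rho>) = vertex_field N k u z (j_field N u z' \<rho>)"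
proof -
  let ?V = "vertex_op N k u z"
  let ?g = "(u - cst (val u z)) powi k"
  let ?b = "Abs_mP (1 / (u - cst (val u z')))"
  let ?s = "complex_of_real (sqrt N)"
  let ?H = "translate (- (?s * of_int k)) z"
  define a where "a = d_at u z'"
  have a: "a \<noteq> 0" unfolding a_def by (rule coordinate_d_at(1)[OF u])
  have \<rho>z: "\<rho> \<in> Wt N {z}" and \<rho>z': "\<rho> \<in> Wt N {z'}"
    using Wt_mono[OF \<rho>] by auto
  have "{z, z'} - {z} = {z'}" using assms(2) by auto
  then have V\<rho>: "?V \<rho> \<in> Wt N {z'}"
    using vertex_op_Wt[OF u \<rho>, of z k] by simp
  \<comment> \<open>The function \<open>1/(u - u(z'))\<close> has a pole at \<open>z'\<close> but is regular at \<open>z\<close>.\<close>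
  have "eps_field u z' \<rho> \<in> Wt N {z}"
    using assms(2) by (intro eps_field_Wt[OF u \<rho>z]) auto
  moreover have "iota_op N z' \<rho> \<in> Wt N {z}"
    by (rule Wt_mono[OF iota_op_Wt[OF \<rho>]]) auto
  ultimately have j\<rho>: "eps_field u z' \<rho> + iota_op N z' \<rho> \<in> Wt N {z}" by (rule Wt_add)
  have bz: "coeff_mP 0 z ?b = 1 / (a * (z - z'))"
  proof -
    have "unit_at z (inverse (u - cst (val u z')))"
      using assms(2) by (intro unit_at_inverse unit_at_coordinate_minus[OF u])
    then have "regular_at (fun_of ?b) z" unfolding fun_of_eps[OF u] unit_at_def by blast
    then have "coeff_mP 0 z ?b = val (fun_of ?b) z" by (rule coeff_mP_regular(1))
    also have "\<dots> = 1 / (a * (z - z'))"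
      unfolding fun_of_eps[OF u] val_inverse coordinate_d_at(3)[OF u] a_def by (rule inverse_eq_divide)
    finally show ?thesis .
  qed
  have "(eps_field u z' (?V \<rho>) + iota_op N z' (?V \<rho>)) \<tau> =
      ?V (eps_field u z' \<rho> + iota_op N z' \<rho>) \<tau>" for \<tau>
  proof -
    define \<sigma> where "\<sigma> = ?g * \<tau>"
    define c where "c = vertex_factor N k u z \<sigma>"
    define v where "v = \<rho> \<sigma>"
    have V: "?V \<rho> \<tau> = sconst c * ?H v"
      by (simp add: vertex_op_def Let_def \<sigma>_def c_def v_def)
    \<comment> \<open>Both sides act on the same vector \<open>v\<close>; in \<open>L\<close> the derivation has been moved past the translation.\<close>
    have L: "(eps_field u z' (?V \<rho>) + iota_op N z' (?V \<rho>)) \<tau> =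
        sconst a * (sgen ?b * (sconst c * ?H v)) + (sconst c * ?H (sderiv z' v) -
          sconst (?s * dlog \<tau> z') * (sconst c * ?H v))"
      by (simp add: eps_field_def smul_def fmul_def iota_op_def V a_def sderiv_mult sderiv_translate)
    have R: "?V (eps_field u z' \<rho> + iota_op N z' \<rho>) \<tau> =
        sconst c * ?H (sconst a * (sgen ?b * v) + (sderiv z' v - sconst (?s * dlog \<sigma> z') * v))"
      by (simp add: vertex_op_def Let_def \<sigma>_def[symmetric] c_def v_def eps_field_def smul_def
          fmul_def iota_op_def a_def)
    have Hdiff: "?H (x - y) = ?H x - ?H y" for x y
      using translate_add[of _ z "x - y" y] by (simp add: algebra_simps)
    show ?thesis
    proof (cases "v = 0")
      case True
      then show ?thesis unfolding L R by simp
    next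
      case False
      then have "unit_at z' \<sigma>" using is_stateD(2)[of N "{z, z'}" \<rho>] \<rho> by (simp add: Wt_iff v_def)
      moreover have g: "unit_at z' ?g"
        using assms(2) by (intro coordinate_power(3)[OF u]) auto
      moreover have "\<tau> = inverse ?g * \<sigma>"
        using coordinate_power(1)[OF u, of z k] by (simp add: \<sigma>_def mult.assoc[symmetric])
      ultimately have "unit_at z' \<tau>" by (simp only: unit_at_mult unit_at_inverse)
      then have D: "dlog \<sigma> z' = of_int k / (z' - z) + dlog \<tau> z'"
        unfolding \<sigma>_def using assms(2) dlog_mult[OF g] coordinate_power(5)[OF u, of z' z k] by simp
      have "of_int k / (z' - z) = - (of_int k / (z - z'))"
        by (metis minus_diff_eq minus_divide_right)
      also have "\<dots> = a * (- of_int k * (1 / (a * (z - z'))))"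
        using a by simp
      finally have "?s * dlog \<sigma> z' = ?s * dlog \<tau> z' + a * (- (?s * of_int k) * (1 / (a * (z - z'))))"
        unfolding D by (simp only: distrib_left) (simp add: algebra_simps)
      then have "sconst (?s * dlog \<sigma> z') =
          sconst (?s * dlog \<tau> z') + sconst a * sconst (- (?s * of_int k) * coeff_mP 0 z ?b)"
        by (simp only: sconst_add sconst_mult bz)
      then show ?thesis
        unfolding L R Hdiff translate_add translate_mult translate_const translate_gen
        by (simp only: algebra_simps)
    qed
  qed
  then have "eps_field u z' (?V \<rho>) + iota_op N z' (?V \<rho>) = ?V (eps_field u z' \<rho> + iota_op N z' \<rho>)"
    by (rule ext)
  then show ?thesis
    unfolding j_field_def vertex_field_eq[OF u \<rho>z] iota_field_eq[OF V\<rho>] iota_field_eq[OF \<rho>z']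
      vertex_field_eq[OF u j\<rho>] .
qed

text \<open>
  The comparison of the scalars of the two products of vertex fields on a section of degree \<open>d\<close>
  with value \<open>t\<close> at \<open>z\<close> and \<open>s\<close> at \<open>z'\<close>, where \<open>a = du\<close> and \<open>x = u(z') - u(z)\<close>: the powers of
  \<open>a\<close>, \<open>s\<close> and \<open>t\<close> agree, and those of \<open>x\<close> and of \<open>- x\<close> differ by the sign.
\<close>

lemma scalar_exchange:
  fixes a x s t :: complex and n k k' d :: int
  assumes "a \<noteq> 0" "x \<noteq> 0"
  shows "(s / x powi k) powi (n * k') * a powi (- n * k' * ((d + k) + k')) *
           (t powi (n * k) * a powi (- n * k * (d + k))) =
         (- 1) powi (n * k * k') * ((t / (- x) powi k') powi (n * k) *
           a powi (- n * k * ((d + k') + k)) * (s powi (n * k') * a powi (- n * k' * (d + k'))))"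
proof -
  have e: "k * (n * k') = n * k * k'" "k' * (n * k) = n * k * k'" by simp_all
  have m: "(- x) powi (n * k * k') = (- 1) powi (n * k * k') * x powi (n * k * k')"
    using power_int_mult_distrib[of "-1" x "n * k * k'"] by simp
  have A: "a powi (- n * k' * ((d + k) + k')) * a powi (- n * k * (d + k)) =
      a powi (- n * k * ((d + k') + k)) * a powi (- n * k' * (d + k'))"
    using assms(1) by (simp add: power_int_add[symmetric] algebra_simps)
  have "(- 1 :: complex) powi (n * k * k') \<noteq> 0" by simp
  then have B: "(s / x powi k) powi (n * k') * t powi (n * k) =
      (- 1) powi (n * k * k') * ((t / (- x) powi k') powi (n * k) * s powi (n * k'))"
    using assms(2)
    by (simp only: power_int_divide_distrib power_int_mult[symmetric] e m) (simp add: field_simps)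
  have exchange: "s1 * a1 * (t1 * a2) = m * (t2 * a3 * (s2 * a4))"
    if "a1 * a2 = a3 * a4" "s1 * t1 = m * (t2 * s2)" for s1 a1 t1 a2 m t2 a3 s2 a4 :: complex
  proof -
    have "s1 * a1 * (t1 * a2) = (s1 * t1) * (a1 * a2)" by (simp only: mult_ac)
    also have "\<dots> = (m * (t2 * s2)) * (a3 * a4)" by (simp only: that)
    also have "\<dots> = m * (t2 * a3 * (s2 * a4))" by (simp only: mult_ac)
    finally show ?thesis .
  qed
  show ?thesis by (rule exchange[OF A B])
qed

lemma vertex_exchange:
  assumes u: "coordinate u" and "z \<noteq> z'" and \<rho>: "\<rho> \<in> Wt N {z, z'}"
  shows "vertex_field N k' u z' (vertex_field N k u z \<rho>) =
    smul ((- 1) powi (int N * k * k')) (vertex_field N k u z (vertex_field N k' u z' \<rho>))"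
proof -
  let ?V = "vertex_op N k u z" and ?V' = "vertex_op N k' u z'"
  let ?g = "(u - cst (val u z)) powi k" and ?g' = "(u - cst (val u z')) powi k'"
  let ?H = "translate (- (complex_of_real (sqrt N) * of_int k)) z"
  let ?H' = "translate (- (complex_of_real (sqrt N) * of_int k')) z'"
  have \<rho>z: "\<rho> \<in> Wt N {z}" and \<rho>z': "\<rho> \<in> Wt N {z'}"
    using Wt_mono[OF \<rho>] by auto
  have "{z, z'} - {z} = {z'}" "{z, z'} - {z'} = {z}" using assms(2) by auto
  then have V\<rho>: "?V \<rho> \<in> Wt N {z'}" and V'\<rho>: "?V' \<rho> \<in> Wt N {z}"
    using vertex_op_Wt[OF u \<rho>, of z k] vertex_op_Wt[OF u \<rho>, of z' k'] by simp_all
  have "?V' (?V \<rho>) \<tau> = smul ((- 1) powi (int N * k * k')) (?V (?V' \<rho>)) \<tau>" for \<tau>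
  proof -
    define \<sigma> where "\<sigma> = ?g * (?g' * \<tau>)"
    define v where "v = \<rho> \<sigma>"
    have \<sigma>': "\<sigma> = ?g' * (?g * \<tau>)" by (simp only: \<sigma>_def mult.left_commute)
    have L: "?V' (?V \<rho>) \<tau> =
        sconst (vertex_factor N k' u z' (?g' * \<tau>) * vertex_factor N k u z \<sigma>) * ?H' (?H v)"
      by (simp add: vertex_op_def Let_def \<sigma>_def v_def translate_mult sconst_mult mult.assoc)
    have R: "?V (?V' \<rho>) \<tau> =
        sconst (vertex_factor N k u z (?g * \<tau>) * vertex_factor N k' u z' \<sigma>) * ?H (?H' v)"
      by (simp add: vertex_op_def Let_def \<sigma>' v_def translate_mult sconst_mult mult.assoc)
    show ?thesis
    proof (cases "v = 0")
      case True
      then show ?thesis unfolding smul_def L R by simp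
    next
      case False
      have is_state: "is_state N {z, z'} \<rho>" using \<rho> by (simp only: Wt_iff)
      have \<sigma>: "\<sigma> \<noteq> 0" "unit_at z \<sigma>" "unit_at z' \<sigma>"
        using is_stateD(1,2)[OF is_state False[unfolded v_def]] by auto
      have g0: "?g \<noteq> 0" "?g' \<noteq> 0" by (rule coordinate_power(1)[OF u])+
      have \<tau>: "\<tau> \<noteq> 0" using \<sigma>(1) by (auto simp: \<sigma>_def)
      have deg: "degP (?g' * \<tau>) = degP \<sigma> + k" "degP (?g * \<tau>) = degP \<sigma> + k'"
        using g0 \<tau> by (simp_all add: \<sigma>_def degP_mult coordinate_power(2)[OF u])
      have unit: "unit_at z' ?g" "unit_at z ?g'"
        using assms(2) by (auto intro!: coordinate_power(3)[OF u])
      have inv: "?g' * \<tau> = inverse ?g * \<sigma>" "?g * \<tau> = inverse ?g' * \<sigma>"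
        using g0 by (simp_all add: \<sigma>_def mult.left_commute[of _ ?g'] mult.assoc[symmetric])
      define a where "a = d_at u z"
      have a: "a \<noteq> 0" "d_at u z' = a"
        unfolding a_def by (rule coordinate_d_at(1)[OF u], rule coordinate_d_at(2)[OF u])
      have "val (?g' * \<tau>) z' = val \<sigma> z' / (a * (z' - z)) powi k"
        unfolding inv val_mult_unit[OF unit_at_inverse[OF unit(1)] \<sigma>(3)]
        using assms(2) by (simp add: coordinate_power(4)[OF u] a_def divide_inverse)
      moreover have "val (?g * \<tau>) z = val \<sigma> z / (- (a * (z' - z))) powi k'"
        unfolding inv val_mult_unit[OF unit_at_inverse[OF unit(2)] \<sigma>(2)]
        using assms(2) by (simp add: coordinate_power(4)[OF u] a divide_inverse algebra_simps)
      ultimately have "vertex_factor N k' u z' (?g' * \<tau>) * vertex_factor N k u z \<sigma> =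
          (- 1) powi (int N * k * k') *
            (vertex_factor N k u z (?g * \<tau>) * vertex_factor N k' u z' \<sigma>)"
        unfolding vertex_factor_def deg a(2) a_def[symmetric]
        using scalar_exchange[of a "a * (z' - z)" "val \<sigma> z'" k "int N" k' "degP \<sigma>" "val \<sigma> z"]
          a(1) assms(2) by simp
      then show ?thesis
        unfolding smul_def L R
        by (simp only: sconst_mult translate_commute[of _ z' _ z] mult.assoc)
    qed
  qed
  then have "?V' (?V \<rho>) = smul ((- 1) powi (int N * k * k')) (?V (?V' \<rho>))" by (rule ext)
  then show ?thesis
    unfolding vertex_field_eq[OF u \<rho>z] vertex_field_eq[OF u \<rho>z'] vertex_field_eq[OF u V\<rho>]
      vertex_field_eq[OF u V'\<rho>] .
qed

theorem proposition15p2: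
  fixes N :: nat and k k' :: int and u :: mero and z z' :: complex
  assumes "N > 0" and "coordinate u" and "z \<noteq> z'"
  shows "(\<forall>\<rho>\<in>Wt N {z, z'}.
            j_field N u z' (vertex_field N k u z \<rho>) - vertex_field N k u z (j_field N u z' \<rho>) = 0)
       \<and> (\<forall>\<rho>\<in>Wt N {z, z'}.
            vertex_field N k' u z' (vertex_field N k u z \<rho>) =
              smul ((- 1) powi (int N * k * k'))
                (vertex_field N k u z (vertex_field N k' u z' \<rho>)))"
  using j_commutes_with_vertex[OF assms(2,3)] vertex_exchange[OF assms(2,3)]
  unfolding right_minus_eq by blast

end
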